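(* Let $\Gamma$ be a discrete cocompact subgroup of $SU(2,1)$ such that $X_\Gamma=\Gamma\backslash B^2$ is smooth, let $\gamma_0\in\Gamma$ be hyperbolic, let $\Gamma_0=\langle\gamma_0\rangle$, and let $k,l$ be positive integers. With $A$, $\gamma=A^{-1}\gamma_0A$, $\tilde T(l)$, $T(l)=\langle\gamma\rangle\backslash\tilde T(l)$ and $\tilde\Lambda(l)=A\tilde T(l)$ as defined in the context, $$\Lambda(l):=AT(l)=\Gamma_0\backslash\tilde\Lambda(l)$$ is a compact Legendrian submanifold of $P$.
   Context: $B^2$ is the open unit ball in $\mathbb{C}^2$. On $\mathbb{C}^3$ let $\langle z,w\rangle=z_1\bar w_1+z_2\bar w_2-z_3\bar w_3$. A nonzero vector $z$ is null if $\langle z,z\rangle=0$ and positive if $\langle z,z\rangle>0$. A point $z\in B^2$ is identified with $(z_1,z_2,1)^T$ inside $\langle\cdot,\cdot\rangle$, so $\langle z,z\rangle=|z_1|^2+|z_2|^2-1$. The group $SU(2,1)$ acts on $B^2$ by fractional-linear transformations, and $J(g,z)$ denotes the Jacobi matrix of $g$ at $z$. An automorphism of $B^2$ is loxodromic if it has no fixed points in $B^2$ and fixes two points of $\partial B^2$. A loxodromic automorphism is hyperbolic if it has a lift to $U(2,1)$ all of whose eigenvalues are real. Bundles. Let $L=\Lambda^2T^*X_\Gamma$ and $\tilde L=\Lambda^2T^*B^2$ be the canonical line bundles, with duals $L^*$ and $\tilde L^*$. The unit circle bundle in $\tilde L^*$ is $$\tilde P=\{(z,\zeta):\ z\in B^2,\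 \zeta\in\mathbb{C},\ |\zeta|=(-\langle z,z\rangle)^{3/2}\},$$ on which $g\in SU(2,1)$ acts by $g(z,\zeta)=(gz,\zeta\det J(g,z))$, and $P=\Gamma\backslash\tilde P$ is the unit circle bundle in $L^*$. The connection form $$\alpha=\theta+i\frac{d\zeta}{\zeta},\qquad \theta=-3i\,\partial\ln(-\langle z,z\rangle),$$ where $d=\partial+\bar\partial$, serves as the contact form on $\tilde P$ and on $P$. A 2-dimensional submanifold of the 5-dimensional manifold $P$ is Legendrian if $\alpha$ restricts to $0$ on it. The matrix $A$. Let $X,Y$ be the null eigenvectors and $v$ the positive eigenvector of $\gamma_0$; the corresponding eigenvalues are $\lambda,\lambda^{-1},1$ with $\lambda\in\mathbb{R}$, $|\lambda|>1$. Choose $v$ so that the matrix with columns $$A=\left[\,v\ \ \ \tfrac{X}{\langle X,Y\rangle}+\tfrac{Y}{2}\ \ \ \tfrac{X}{\langle X,Y\rangle}-\tfrac{Y}{2}\,\right]$$ belongs to $SU(2,1)$, and put $\gamma=A^{-1}\gamma_0A$. Coordinates and submanifolds. For $w=(w_1,w_2)\in B^2$ use the change of variables $$w_2=\frac{re^{i\phi}-i}{re^{i\phi}+i},\qquad w_1=\sqrt{1-w_2\bar w_2}\,Re^{i\Theta},\qquad 0<\phi<\pi,\ 0<r<+\infty,\ 0<R<1,\ 0\le\Theta<2\pi.$$ Define $$\tilde T(l)=\left\{\left(w,(-\langle w,w\rangle)^{3/2}e^{i\psi}\right):\ w\in\left\{\phi=\tfrac{\pi}{2},\ R=\sqrt{\tfrac{l}{3k+l}}\right\},\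 \psi=-\tfrac{l}{k}\Theta\right\}\subset\tilde P,$$ $T(l)=\langle\gamma\rangle\backslash\tilde T(l)$ and $\tilde\Lambda(l)=A\tilde T(l)$. The set $\Lambda(l)=\Gamma_0\backslash\tilde\Lambda(l)$ is regarded in $P$ via the natural projection.
   Formalization: Θ in the definition of T̃(l) runs over all reals rather than [0,2π), since otherwise Λ(l) is not compact unless k divides l; "submanifold of P" means that Γ₀\Λ̃(l) is a compact surface immersed in P by the natural projection, not necessarily injectively. *)

theory Defs
  imports "HOL-Analysis.Analysis" "HOL-Algebra.Group_Action" "HOL-Algebra.Generated_Groups"
begin

section \<open>The Hermitian form, its unitary groups and the ball\<close>

definition herm :: "complex^3 \<Rightarrow> complex^3 \<Rightarrow> complex" where
  "herm z w = z$1 * cnj (w$1) + z$2 * cnj (w$2) - z$3 * cnj (w$3)"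

definition null_vec :: "complex^3 \<Rightarrow> bool" where
  "null_vec z \<longleftrightarrow> z \<noteq> 0 \<and> herm z z = 0"

definition positive_vec :: "complex^3 \<Rightarrow> bool" where
  "positive_vec z \<longleftrightarrow> z \<noteq> 0 \<and> Re (herm z z) > 0"

definition U21 :: "(complex^3^3) set" where
  "U21 = {g. \<forall>z w. herm (g *v z) (g *v w) = herm z w}"

definition SU21 :: "(complex^3^3) monoid" where
  "SU21 = \<lparr>carrier = {g \<in> U21. det g = 1}, mult = (**), one = mat 1\<rparr>"

abbreviation Ball2 :: "(complex^2) set" where
  "Ball2 \<equiv> ball 0 1"

definition homog :: "complex^2 \<Rightarrow> complex^3" where
  "homog z = vector [z$1, z$2, 1]"

text \<open>\<open>rho z\<close> is \<open>- \<langle>z, z\<rangle>\<close>, a positive real number for \<open>z\<close> in the ball.\<close>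

definition rho :: "complex^2 \<Rightarrow> real" where
  "rho z = - Re (herm (homog z) (homog z))"

definition moebius :: "complex^3^3 \<Rightarrow> complex^2 \<Rightarrow> complex^2" where
  "moebius g z = vector [(g *v homog z)$1 / (g *v homog z)$3, (g *v homog z)$2 / (g *v homog z)$3]"

definition jacobi :: "complex^3^3 \<Rightarrow> complex^2 \<Rightarrow> complex^2^2" where
  "jacobi g z =
     (\<chi> i j. deriv (\<lambda>t. moebius g (\<chi> m. if m = j then t else z$m) $ i) (z$j))"

section \<open>Loxodromic and hyperbolic automorphisms\<close>

definition loxodromic :: "complex^3^3 \<Rightarrow> bool" where
  "loxodromic g \<longleftrightarrow> (\<forall>z \<in> Ball2. moebius g z \<noteq> z) \<and> card {z \<in> sphere 0 1. moebius g z = z} = 2"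

definition is_lift :: "complex^3^3 \<Rightarrow> complex^3^3 \<Rightarrow> bool" where
  "is_lift M g \<longleftrightarrow> M \<in> U21 \<and> (\<forall>z \<in> Ball2. moebius M z = moebius g z)"

definition hyperbolic :: "complex^3^3 \<Rightarrow> bool" where
  "hyperbolic g \<longleftrightarrow> loxodromic g \<and>
     (\<exists>M. is_lift M g \<and> (\<forall>c x. x \<noteq> 0 \<and> M *v x = c *s x \<longrightarrow> c \<in> \<real>))"

section \<open>Orbit spaces\<close>

abbreviation SUsub :: "(complex^3^3) set \<Rightarrow> (complex^3^3) monoid" where
  "SUsub \<Gamma> \<equiv> SU21\<lparr>carrier := \<Gamma>\<rparr>"

text \<open>The orbit set with the quotient topology.\<close>

definition orbit_space ::
    "('g, 'm) monoid_scheme \<Rightarrow> 'b::topological_space set \<Rightarrow> ('g \<Rightarrow> 'b \<Rightarrow> 'b) \<Rightarrow> 'b set topology" where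
  "orbit_space G E \<phi> =
     topology (\<lambda>U. U \<subseteq> orbits G E \<phi> \<and> openin (top_of_set E) {x \<in> E. orbit G \<phi> x \<in> U})"

lemma openin_orbit_space:
  "openin (orbit_space G E \<phi>) U \<longleftrightarrow>
     U \<subseteq> orbits G E \<phi> \<and> openin (top_of_set E) {x \<in> E. orbit G \<phi> x \<in> U}"
proof -
  have "istopology (\<lambda>U. U \<subseteq> orbits G E \<phi> \<and> openin (top_of_set E) {x \<in> E. orbit G \<phi> x \<in> U})"
    (is "istopology ?L")
    unfolding istopology_def
  proof (intro conjI allI impI)
    fix S T assume S: "?L S" and T: "?L T"
    have eq: "{x \<in> E. orbit G \<phi> x \<in> S \<inter> T} =
        {x \<in> E. orbit G \<phi> x \<in> S} \<inter> {x \<in> E. orbit G \<phi> x \<in> T}"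
      by (rule Set.set_eqI) blast
    show "S \<inter> T \<subseteq> orbits G E \<phi>" using S by (simp add: le_infI1)
    show "openin (top_of_set E) {x \<in> E. orbit G \<phi> x \<in> S \<inter> T}"
      unfolding eq using S T by (intro openin_Int) simp_all
  next
    fix K assume K: "\<forall>S\<in>K. ?L S"
    have eq: "{x \<in> E. orbit G \<phi> x \<in> \<Union>K} = \<Union>((\<lambda>S. {x \<in> E. orbit G \<phi> x \<in> S}) ` K)"
      by (rule Set.set_eqI) simp
    show "\<Union>K \<subseteq> orbits G E \<phi>" using K by (simp add: Sup_le_iff)
    show "openin (top_of_set E) {x \<in> E. orbit G \<phi> x \<in> \<Union>K}"
      unfolding eq using K by (intro openin_Union) (blast elim: imageE)
  qed
  then show ?thesis
    by (simp only: orbit_space_def topology_inverse')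
qed

lemma topspace_orbit_space: "topspace (orbit_space G E \<phi>) = orbits G E \<phi>"
proof (rule subset_antisym)
  show "topspace (orbit_space G E \<phi>) \<subseteq> orbits G E \<phi>"
    using openin_topspace[of "orbit_space G E \<phi>"] unfolding openin_orbit_space by (rule conjunct1)
  have "orbit G \<phi> x \<in> orbits G E \<phi>" if "x \<in> E" for x
    unfolding orbits_def using that by blast
  then have "{x \<in> E. orbit G \<phi> x \<in> orbits G E \<phi>} = E"
    by blast
  then have "openin (orbit_space G E \<phi>) (orbits G E \<phi>)"
    unfolding openin_orbit_space by simp
  then show "orbits G E \<phi> \<subseteq> topspace (orbit_space G E \<phi>)"
    by (rule openin_subset)
qed

lemma quotient_map_orbit_space:
  "quotient_map (top_of_set E) (orbit_space G E \<phi>) (orbit G \<phi>)"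
proof -
  have "orbit G \<phi> ` E = orbits G E \<phi>"
    unfolding orbits_def by (simp add: Setcompr_eq_image)
  then show ?thesis
    unfolding quotient_map_def topspace_orbit_space openin_orbit_space by simp
qed

definition cocompact :: "(complex^3^3) set \<Rightarrow> bool" where
  "cocompact \<Gamma> \<longleftrightarrow> compact_space (orbit_space (SUsub \<Gamma>) (carrier SU21) (**))"

text \<open>For a discrete group, \<open>X\<^sub>\<Gamma>\<close> is smooth when the projection of the ball onto the orbit space
  is locally injective, so that its local inverses are charts of \<open>X\<^sub>\<Gamma>\<close>. Elements of \<open>\<Gamma>\<close> that act
  trivially (cube roots of unity) are allowed.\<close>

definition smooth_quotient :: "(complex^3^3) set \<Rightarrow> bool" where
  "smooth_quotient \<Gamma> \<longleftrightarrow>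
     (\<forall>z \<in> Ball2. \<exists>U. open U \<and> z \<in> U \<and> U \<subseteq> Ball2 \<and> inj_on (orbit (SUsub \<Gamma>) moebius) U)"

section \<open>The circle bundle and the contact form\<close>

definition Ptilde :: "((complex^2) \<times> complex) set" where
  "Ptilde = {(z, \<zeta>). z \<in> Ball2 \<and> cmod \<zeta> = rho z powr (3/2)}"

definition act :: "complex^3^3 \<Rightarrow> (complex^2) \<times> complex \<Rightarrow> (complex^2) \<times> complex" where
  "act g p = (moebius g (fst p), snd p * det (jacobi g (fst p)))"

abbreviation P_quot :: "(complex^3^3) set \<Rightarrow> ((complex^2) \<times> complex) set topology" where
  "P_quot \<Gamma> \<equiv> orbit_space (SUsub \<Gamma>) Ptilde act"

text \<open>The \<open>(1,0)\<close>-part of the differential of \<open>f\<close>.\<close>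

definition del :: "(complex^2 \<Rightarrow> complex) \<Rightarrow> complex^2 \<Rightarrow> complex^2 \<Rightarrow> complex" where
  "del f z u = (frechet_derivative f (at z) u - \<i> * frechet_derivative f (at z) (\<i> *s u)) / 2"

definition theta_form :: "complex^2 \<Rightarrow> complex^2 \<Rightarrow> complex" where
  "theta_form z u = - 3 * \<i> * del (\<lambda>w. of_real (ln (rho w))) z u"

definition contact_form ::
    "(complex^2) \<times> complex \<Rightarrow> (complex^2) \<times> complex \<Rightarrow> complex" where
  "contact_form p t = theta_form (fst p) (fst t) + \<i> * (snd t / snd p)"

section \<open>Legendrian submanifolds\<close>

primrec Ck_on :: "nat \<Rightarrow> 'a::euclidean_space set \<Rightarrow> ('a \<Rightarrow> 'b::euclidean_space) \<Rightarrow> bool" where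
  "Ck_on 0 U f \<longleftrightarrow> continuous_on U f"
| "Ck_on (Suc n) U f \<longleftrightarrow>
     (\<forall>x\<in>U. f differentiable (at x)) \<and> (\<forall>v. Ck_on n U (\<lambda>x. frechet_derivative f (at x) v))"

definition smooth_on :: "'a::euclidean_space set \<Rightarrow> ('a \<Rightarrow> 'b::euclidean_space) \<Rightarrow> bool" where
  "smooth_on U f \<longleftrightarrow> (\<forall>n. Ck_on n U f)"

text \<open>Let \<open>N\<close> be a topological space with a map \<open>\<iota>\<close> to the orbit space \<open>P\<close> of \<open>\<Gamma>\<close> on
  \<open>Ptilde\<close>. The manifold structure of \<open>P\<close> is the one for which the projection from \<open>Ptilde\<close> is a
  local diffeomorphism, so a smooth map to \<open>P\<close> is given locally by a smooth map to \<open>Ptilde\<close>, and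
  the contact form of \<open>P\<close> pulls back to that of \<open>Ptilde\<close>. A Legendrian patch consists of a
  homeomorphism \<open>h\<close> from an open subset \<open>W\<close> of the plane onto an open subset of \<open>N\<close> and an
  immersion \<open>F\<close> of \<open>W\<close> into \<open>Ptilde\<close> that lifts \<open>\<iota> \<circ> h\<close> and pulls the contact form back
  to \<open>0\<close>.\<close>

definition legendrian_patch ::
    "(complex^3^3) set \<Rightarrow> 'n topology \<Rightarrow> ('n \<Rightarrow> ((complex^2) \<times> complex) set) \<Rightarrow>
     (real^2) set \<Rightarrow> (real^2 \<Rightarrow> 'n) \<Rightarrow> (real^2 \<Rightarrow> (complex^2) \<times> complex) \<Rightarrow> bool" where
  "legendrian_patch \<Gamma> N \<iota> W h F \<longleftrightarrow>
     open W \<and> openin N (h ` W) \<and>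
     homeomorphic_map (top_of_set W) (subtopology N (h ` W)) h \<and>
     F ` W \<subseteq> Ptilde \<and> smooth_on W F \<and>
     (\<forall>x\<in>W. \<iota> (h x) = orbit (SUsub \<Gamma>) act (F x)) \<and>
     (\<forall>x\<in>W. inj (frechet_derivative F (at x))) \<and>
     (\<forall>x\<in>W. \<forall>u. contact_form (F x) (frechet_derivative F (at x) u) = 0)"

text \<open>\<open>N\<close> is a 2-manifold, (possibly non-injectively) immersed in \<open>P\<close> by \<open>\<iota>\<close> as a Legendrian
  submanifold. The patches form a smooth atlas of \<open>N\<close>, as all of them are compatible with the local
  embedding \<open>\<iota>\<close>.\<close>

definition legendrian_submanifold ::
    "(complex^3^3) set \<Rightarrow> 'n topology \<Rightarrow> ('n \<Rightarrow> ((complex^2) \<times> complex) set) \<Rightarrow> bool" where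
  "legendrian_submanifold \<Gamma> N \<iota> \<longleftrightarrow>
     Hausdorff_space N \<and> second_countable N \<and> continuous_map N (P_quot \<Gamma>) \<iota> \<and>
     (\<forall>p \<in> topspace N. \<exists>W h F. legendrian_patch \<Gamma> N \<iota> W h F \<and> p \<in> h ` W)"

section \<open>The surfaces in question\<close>

definition frame_matrix :: "complex^3 \<Rightarrow> complex^3 \<Rightarrow> complex^3 \<Rightarrow> complex^3^3" where
  "frame_matrix v X Y = transpose (vector
     [v, (1 / herm X Y) *s X + (1/2) *s Y, (1 / herm X Y) *s X - (1/2) *s Y])"

definition ball_coords :: "real \<Rightarrow> real \<Rightarrow> real \<Rightarrow> real \<Rightarrow> complex^2" where
  "ball_coords r \<phi> R \<Theta> =
     (let w2 = (of_real r * cis \<phi> - \<i>) / (of_real r * cis \<phi> + \<i>)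
      in vector [of_real (sqrt (1 - (cmod w2)\<^sup>2)) * of_real R * cis \<Theta>, w2])"

text \<open>The fibre coordinate \<open>\<psi> = - (l/k) \<Theta>\<close> is not \<open>2\<pi>\<close>-periodic in \<open>\<Theta>\<close> unless \<open>k\<close> divides \<open>l\<close>.
  The angle \<open>\<Theta>\<close> therefore runs through all real numbers, so that the surface closes up
  after finitely many turns; with \<open>\<Theta>\<close> cut off at \<open>2\<pi>\<close> it would have an edge.\<close>

definition T_tilde :: "nat \<Rightarrow> nat \<Rightarrow> ((complex^2) \<times> complex) set" where
  "T_tilde k l =
     {(w, of_real (rho w powr (3/2)) * cis \<psi>) | w \<psi> r \<Theta>.
        r > 0 \<and> w = ball_coords r (pi/2) (sqrt (real l / (3 * real k + real l))) \<Theta> \<and>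
        \<psi> = - (real l / real k) * \<Theta>}"

definition cyclic :: "complex^3^3 \<Rightarrow> (complex^3^3) set" where
  "cyclic g = generate SU21 {g}"

definition T_quot ::
    "complex^3^3 \<Rightarrow> nat \<Rightarrow> nat \<Rightarrow> ((complex^2) \<times> complex) set set" where
  "T_quot \<gamma> k l = orbits (SUsub (cyclic \<gamma>)) (T_tilde k l) act"

definition Lambda_tilde :: "complex^3^3 \<Rightarrow> nat \<Rightarrow> nat \<Rightarrow> ((complex^2) \<times> complex) set" where
  "Lambda_tilde A k l = act A ` T_tilde k l"

definition Lambda ::
    "complex^3^3 \<Rightarrow> complex^3^3 \<Rightarrow> nat \<Rightarrow> nat \<Rightarrow> ((complex^2) \<times> complex) set set" where
  "Lambda \<gamma>0 A k l = orbits (SUsub (cyclic \<gamma>0)) (Lambda_tilde A k l) act"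

text \<open>The natural projection of an orbit space of \<open>Ptilde\<close> under a subgroup of \<open>\<Gamma>\<close> to \<open>P\<close>.\<close>

definition natural_proj ::
    "(complex^3^3) set \<Rightarrow> ((complex^2) \<times> complex) set \<Rightarrow> ((complex^2) \<times> complex) set" where
  "natural_proj \<Gamma> Q = (\<Union>g\<in>\<Gamma>. act g ` Q)"

end

theory Submission
  imports Defs
begin

text \<open>
  In homogeneous coordinates \<open>z = Z / Z\<^sub>3\<close>, \<open>\<zeta> = \<eta> / Z\<^sub>3\<^sup>3\<close> the group acts by
  \<open>(Z, \<eta>) \<mapsto> (g Z, \<eta>)\<close> and the contact form is \<open>\<i> (d\<eta> / \<eta> - 3 \<langle>dZ, Z\<rangle> / \<langle>Z, Z\<rangle>)\<close>, which is visibly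
  invariant. With \<open>r = exp (2 t)\<close> the surface is
  \<open>Z = A (R e\<^sup>i\<^sup>\<Theta>, sinh t, cosh t)\<close>, \<open>\<eta> = c e\<^sup>-\<^sup>i\<^sup>l\<^sup>\<Theta>\<^sup>/\<^sup>k\<close>; here \<open>\<langle>Z, Z\<rangle> = R\<^sup>2 - 1\<close> and
  \<open>\<langle>dZ, Z\<rangle> = \<i> R\<^sup>2 d\<Theta>\<close>, so the form vanishes exactly because \<open>R\<^sup>2 = l / (3 k + l)\<close>. The generator
  \<open>\<gamma>0\<close> shifts \<open>t\<close> by \<open>ln \<bar>lam\<bar>\<close>. As \<open>t\<close> extends to a continuous function on all of
  \<open>Ptilde\<close> with the same property, the cyclic group acts freely and properly, and its quotient is
  Hausdorff; compactness holds because \<open>t\<close> and \<open>\<Theta>\<close> can be reduced to bounded intervals. If \<open>lam < 0\<close>,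
  then \<open>\<gamma>0\<close> may move the surface to a disjoint copy of itself, but its square preserves it.
\<close>

subsection \<open>Homogeneous coordinates\<close>

lemma matrix_vector_mult_3:
  fixes g :: "complex^3^3"
  shows "(g *v z) $ i = g$i$1 * z$1 + g$i$2 * z$2 + g$i$3 * z$3"
  by (simp add: matrix_vector_mult_def sum_3)

lemma herm_self: "herm z z = of_real (Re (herm z z))"
  by (simp add: herm_def complex_eq_iff algebra_simps)

lemma Re_herm_self: "Re (herm z z) = (cmod (z$1))\<^sup>2 + (cmod (z$2))\<^sup>2 - (cmod (z$3))\<^sup>2"
  by (simp add: herm_def cmod_power2) (simp add: power2_eq_square)

lemma homog_nth [simp]: "homog z $ 1 = z$1" "homog z $ 2 = z$2" "homog z $ 3 = 1"
  by (simp_all add: homog_def)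

lemma rho_eq: "rho z = 1 - (cmod (z$1))\<^sup>2 - (cmod (z$2))\<^sup>2"
  by (simp add: rho_def Re_herm_self)

lemma rho_eq_norm: "rho z = 1 - (norm z)\<^sup>2"
  by (simp add: rho_eq norm_vec_def L2_set_def sum_2)

lemma Ball2_iff: "z \<in> Ball2 \<longleftrightarrow> rho z > 0"
  by (simp add: rho_eq_norm power_less_one_iff abs_square_less_1)

lemma herm_mult_U21: "g \<in> U21 \<Longrightarrow> herm (g *v z) (g *v w) = herm z w"
  by (simp add: U21_def)

text \<open>If the third coordinate vanished, the form would be a sum of two squares. Negative
  vectors therefore lie over the affine chart, and dividing by \<open>Z$3\<close> is legitimate for
  them.\<close>

lemma herm_neg_third: "Re (herm z z) < 0 \<Longrightarrow> z$3 \<noteq> 0"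
  by (auto simp: Re_herm_self not_sum_power2_lt_zero)

lemma herm_homog_Ball2: "z \<in> Ball2 \<Longrightarrow> Re (herm (homog z) (homog z)) < 0"
  unfolding Ball2_iff by (simp add: rho_def)

text \<open>The point of \<open>Ptilde\<close> with homogeneous coordinates \<open>(Z, \<eta>)\<close>, which are determined up to
  \<open>(c Z, c\<^sup>3 \<eta>)\<close>. In these coordinates \<open>SU(2,1)\<close> acts linearly, through \<open>Z\<close> alone.\<close>

definition proj_pt :: "complex^3 \<Rightarrow> complex \<Rightarrow> (complex^2) \<times> complex" where
  "proj_pt Z \<eta> = (vector [Z$1 / Z$3, Z$2 / Z$3], \<eta> / Z$3 ^ 3)"

lemma proj_pt_homog [simp]: "proj_pt (homog z) \<zeta> = (z, \<zeta>)"
  by (simp add: proj_pt_def vec_eq_iff forall_2)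

lemma proj_pt_scale: "c \<noteq> 0 \<Longrightarrow> proj_pt (c *s Z) (c^3 * \<eta>) = proj_pt Z \<eta>"
  by (simp add: proj_pt_def vec_eq_iff forall_2 power_mult_distrib)

lemma rho_proj_pt:
  assumes "Z$3 \<noteq> 0"
  shows "rho (fst (proj_pt Z \<eta>)) = - Re (herm Z Z) / (cmod (Z$3))\<^sup>2"
  using assms by (simp add: rho_eq Re_herm_self proj_pt_def norm_divide power_divide field_simps)

lemma deriv_fractional_linear:
  assumes "c * t + d \<noteq> (0::complex)"
  shows "deriv (\<lambda>t. (a * t + b) / (c * t + d)) t = (a * (c * t + d) - (a * t + b) * c) / (c * t + d)\<^sup>2"
  by (rule DERIV_imp_deriv) (use assms in \<open>auto intro!: derivative_eq_intros simp: power2_eq_square\<close>)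

text \<open>By the quotient rule every entry has denominator \<open>(N$3)\<^sup>2\<close>, and the
  numerators form a matrix of determinant \<open>det g * N$3\<close>. The resulting cube is the
  weight with which \<open>proj_pt\<close> divides \<open>\<eta>\<close>.\<close>

lemma det_jacobi:
  assumes "(g *v homog z)$3 \<noteq> 0"
  shows "det (jacobi g z) = det g / ((g *v homog z)$3)^3"
proof -
  define N where "N = g *v homog z"
  have N: "N$i = g$i$1 * z$1 + g$i$2 * z$2 + g$i$3" for i
    by (simp add: N_def matrix_vector_mult_3)
  have nz: "g$3$1 * z$1 + (g$3$2 * z$2 + g$3$3) \<noteq> 0" "g$3$2 * z$2 + (g$3$1 * z$1 + g$3$3) \<noteq> 0"
    using assms by (simp_all add: matrix_vector_mult_3 ac_simps)
  have J: "jacobi g z $ 1 $ 1 = (g$1$1 * N$3 - N$1 * g$3$1) / (N$3)\<^sup>2"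
    "jacobi g z $ 2 $ 1 = (g$2$1 * N$3 - N$2 * g$3$1) / (N$3)\<^sup>2"
    "jacobi g z $ 1 $ 2 = (g$1$2 * N$3 - N$1 * g$3$2) / (N$3)\<^sup>2"
    "jacobi g z $ 2 $ 2 = (g$2$2 * N$3 - N$2 * g$3$2) / (N$3)\<^sup>2"
    unfolding N
    using deriv_fractional_linear[OF nz(1), of "g$1$1" "g$1$2 * z$2 + g$1$3"]
      deriv_fractional_linear[OF nz(1), of "g$2$1" "g$2$2 * z$2 + g$2$3"]
      deriv_fractional_linear[OF nz(2), of "g$1$2" "g$1$1 * z$1 + g$1$3"]
      deriv_fractional_linear[OF nz(2), of "g$2$2" "g$2$1 * z$1 + g$2$3"]
    by (simp_all add: jacobi_def moebius_def matrix_vector_mult_3 ac_simps)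
  have nz3: "N$3 \<noteq> 0"
    using assms by (simp add: N_def)
  have "(g$1$1 * N$3 - N$1 * g$3$1) * (g$2$2 * N$3 - N$2 * g$3$2)
      - (g$1$2 * N$3 - N$1 * g$3$2) * (g$2$1 * N$3 - N$2 * g$3$1) = det g * N$3"
    unfolding N det_3 by (simp add: algebra_simps)
  then have "det (jacobi g z) = det g * N$3 / ((N$3)\<^sup>2 * (N$3)\<^sup>2)"
    unfolding det_2 J by (simp add: diff_divide_distrib[symmetric])
  also have "\<dots> = det g / (N$3)^3"
    using nz3 by (simp add: power2_eq_square power3_eq_cube)
  finally show ?thesis
    by (simp add: N_def)
qed

text \<open>Derivatives are local and the ball is open. This matters because a lift agrees with the
  given automorphism on the ball only.\<close>

lemma jacobi_cong:
  assumes "z \<in> Ball2" "\<And>w. w \<in> Ball2 \<Longrightarrow> moebius g w = moebius h w"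
  shows "jacobi g z = jacobi h z"
proof -
  have "deriv (\<lambda>t. moebius g (\<chi> m. if m = j then t else z$m) $ i) (z$j)
      = deriv (\<lambda>t. moebius h (\<chi> m. if m = j then t else z$m) $ i) (z$j)" for i j
  proof (rule deriv_cong_ev)
    have "((\<lambda>t. \<chi> m. if m = j then t else z$m) \<longlongrightarrow> (\<chi> m. if m = j then z$j else z$m)) (nhds (z$j))"
      by (intro tendsto_vec_lambda) (auto intro: filterlim_ident)
    also have "(\<chi> m. if m = j then z$j else z$m) = z"
      by (simp add: vec_eq_iff)
    finally have "\<forall>\<^sub>F t in nhds (z$j). (\<chi> m. if m = j then t else z$m) \<in> Ball2"
      using assms(1) by (intro topological_tendstoD[where l = z]) auto
    then show "\<forall>\<^sub>F t in nhds (z$j). moebius g (\<chi> m. if m = j then t else z$m) $ i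
        = moebius h (\<chi> m. if m = j then t else z$m) $ i"
      by eventually_elim (simp add: assms(2))
  qed simp
  then show ?thesis
    by (simp add: jacobi_def vec_eq_iff)
qed

lemma act_cong:
  assumes "fst p \<in> Ball2" "\<And>w. w \<in> Ball2 \<Longrightarrow> moebius g w = moebius h w"
  shows "act g p = act h p"
  using assms jacobi_cong[of "fst p" g h] by (simp add: act_def)

subsection \<open>The group SU(2,1) and its action on the circle bundle\<close>

lemma carrier_SU21: "g \<in> carrier SU21 \<longleftrightarrow> g \<in> U21 \<and> det g = 1"
  by (simp add: SU21_def)

lemma mult_SU21 [simp]: "g \<otimes>\<^bsub>SU21\<^esub> h = g ** h"
  by (simp add: SU21_def)

lemma one_SU21 [simp]: "\<one>\<^bsub>SU21\<^esub> = mat 1"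
  by (simp add: SU21_def)

lemma matrix_inv_SU21:
  assumes "g \<in> carrier SU21"
  shows "matrix_inv g \<in> carrier SU21" "matrix_inv g ** g = mat 1" "g ** matrix_inv g = mat 1"
proof -
  have g: "g \<in> U21" "det g = 1"
    using assms by (simp_all add: carrier_SU21)
  then have "\<exists>g'. g ** g' = mat 1 \<and> g' ** g = mat 1"
    by (metis invertible_def invertible_det_nz zero_neq_one)
  then have "g ** matrix_inv g = mat 1 \<and> matrix_inv g ** g = mat 1"
    unfolding matrix_inv_def by (rule someI_ex)
  then show eqs: "matrix_inv g ** g = mat 1" "g ** matrix_inv g = mat 1"
    by blast+
  have "det (matrix_inv g) * det g = 1"
    by (simp flip: det_mul add: eqs)
  moreover have "herm (matrix_inv g *v z) (matrix_inv g *v w) = herm z w" for z w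
    using herm_mult_U21[OF g(1), of "matrix_inv g *v z" "matrix_inv g *v w"]
    by (simp add: matrix_vector_mul_assoc eqs)
  ultimately show "matrix_inv g \<in> carrier SU21"
    using g(2) by (simp add: carrier_SU21 U21_def)
qed

lemma group_SU21: "group SU21"
proof (rule groupI)
  fix x y z
  assume x: "x \<in> carrier SU21" and "y \<in> carrier SU21" "z \<in> carrier SU21"
  then show "x \<otimes>\<^bsub>SU21\<^esub> y \<in> carrier SU21"
    by (auto simp: carrier_SU21 U21_def det_mul simp flip: matrix_vector_mul_assoc)
  show "x \<otimes>\<^bsub>SU21\<^esub> y \<otimes>\<^bsub>SU21\<^esub> z = x \<otimes>\<^bsub>SU21\<^esub> (y \<otimes>\<^bsub>SU21\<^esub> z)"
    by (simp add: matrix_mul_assoc)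
  show "\<exists>y\<in>carrier SU21. y \<otimes>\<^bsub>SU21\<^esub> x = \<one>\<^bsub>SU21\<^esub>"
    using matrix_inv_SU21[OF x] by auto
qed (simp_all add: carrier_SU21 U21_def)

text \<open>Factor out \<open>Z$3\<close>, so that \<open>Z\<close> becomes a multiple of
  \<open>homog z\<close>. As \<open>det g = 1\<close>, the Jacobi determinant contributes exactly
  the cube of the new third coordinate, and \<open>\<eta>\<close> is left unchanged.\<close>

lemma act_proj_pt:
  assumes g: "g \<in> carrier SU21" and Z: "Re (herm Z Z) < 0"
  shows "act g (proj_pt Z \<eta>) = proj_pt (g *v Z) \<eta>"
proof -
  define z where "z = fst (proj_pt Z \<eta>)"
  have Z3: "Z$3 \<noteq> 0"
    using Z by (rule herm_neg_third)
  have hz: "Z = Z$3 *s homog z"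
    using Z3 by (simp add: z_def proj_pt_def vec_eq_iff forall_3)
  have gZ: "g *v Z = Z$3 *s (g *v homog z)"
    by (subst hz) (simp add: vector_scalar_commute)
  have "(g *v Z)$3 \<noteq> 0"
    using Z g by (intro herm_neg_third) (simp add: herm_mult_U21 carrier_SU21)
  then have nz: "(g *v homog z)$3 \<noteq> 0"
    by (simp add: gZ)
  have "act g (proj_pt Z \<eta>) = (moebius g z, \<eta> / Z$3^3 * (1 / ((g *v homog z)$3)^3))"
    using det_jacobi[OF nz] g by (simp add: act_def z_def carrier_SU21) (simp add: proj_pt_def)
  also have "\<dots> = proj_pt (g *v Z) \<eta>"
    using Z3 by (simp add: gZ moebius_def proj_pt_def power_mult_distrib)
  finally show ?thesis .
qed

text \<open>The exponents fit: passing to the affine representative divides the norm form by the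
  square of \<open>cmod (Z$3)\<close>, and the power 3/2 of that square is the cube by which
  \<open>\<eta>\<close> is divided.\<close>

lemma proj_pt_in_Ptilde:
  assumes "Re (herm Z Z) < 0" "cmod \<eta> = (- Re (herm Z Z)) powr (3/2)"
  shows "proj_pt Z \<eta> \<in> Ptilde"
proof -
  have Z3: "cmod (Z$3) > 0"
    using herm_neg_third[OF assms(1)] by simp
  have "((cmod (Z$3))\<^sup>2) powr (3/2) = cmod (Z$3) ^ 3"
    using Z3 powr_powr[of "cmod (Z$3)" 2 "3/2"] by simp
  then have "cmod (\<eta> / Z$3 ^ 3) = rho (fst (proj_pt Z \<eta>)) powr (3/2)"
    using assms Z3 powr_divide[of "- Re (herm Z Z)" "(cmod (Z$3))\<^sup>2" "3/2"]
    by (simp add: rho_proj_pt norm_divide norm_power)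
  moreover have "rho (fst (proj_pt Z \<eta>)) > 0"
    using assms Z3 by (simp add: rho_proj_pt divide_neg_pos)
  ultimately show ?thesis
    unfolding Ptilde_def Ball2_iff by (simp add: proj_pt_def)
qed

lemma herm_homog_Ptilde: "p \<in> Ptilde \<Longrightarrow> Re (herm (homog (fst p)) (homog (fst p))) < 0"
  by (intro herm_homog_Ball2) (auto simp: Ptilde_def)

lemma act_eq_proj_pt:
  assumes "g \<in> carrier SU21" "p \<in> Ptilde"
  shows "act g p = proj_pt (g *v homog (fst p)) (snd p)"
  using act_proj_pt[OF assms(1) herm_homog_Ptilde[OF assms(2)], of "snd p"] by simp

lemma act_in_Ptilde:
  assumes "g \<in> carrier SU21" "p \<in> Ptilde"
  shows "act g p \<in> Ptilde"
  unfolding act_eq_proj_pt[OF assms] using herm_homog_Ptilde[OF assms(2)] assms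
  by (intro proj_pt_in_Ptilde) (auto simp: herm_mult_U21 carrier_SU21 Ptilde_def rho_def)

text \<open>The chain rule for Jacobi determinants is hidden in the homogeneous coordinates, where
  both sides are the linear action of a matrix product.\<close>

lemma act_mult:
  assumes "g \<in> carrier SU21" "h \<in> carrier SU21" "p \<in> Ptilde"
  shows "act (g ** h) p = act g (act h p)"
proof -
  have "g ** h \<in> carrier SU21"
    using group.is_monoid[OF group_SU21] assms monoid.m_closed by fastforce
  then show ?thesis
    using assms act_proj_pt[OF assms(1), of "h *v homog (fst p)" "snd p"]
    by (simp add: act_eq_proj_pt herm_mult_U21 carrier_SU21 matrix_vector_mul_assoc herm_homog_Ptilde)
qed

lemma mat_1_SU21: "mat 1 \<in> carrier SU21"
  by (simp add: carrier_SU21 U21_def)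

lemma act_one: "p \<in> Ptilde \<Longrightarrow> act (mat 1) p = p"
  by (simp add: act_eq_proj_pt mat_1_SU21)

lemma continuous_on_vector_2 [continuous_intros]:
  fixes f g :: "'a::topological_space \<Rightarrow> 'b::real_normed_vector"
  assumes "continuous_on S f" "continuous_on S g"
  shows "continuous_on S (\<lambda>x. vector [f x, g x] :: 'b^2)"
proof -
  have eq: "(\<lambda>x. vector [f x, g x] :: 'b^2) = (\<lambda>x. \<chi> i. if i = 1 then f x else g x)"
    by (auto simp: vec_eq_iff forall_2)
  have "continuous_on S (\<lambda>x. if i = 1 then f x else g x)" for i :: 2
    using assms by (cases "i = 1") auto
  then show ?thesis
    unfolding eq by (rule continuous_on_vec_lambda)
qed

text \<open>\<open>act\<close> is defined through \<open>deriv\<close>, so continuity is read off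
  its homogeneous form, a quotient with nonvanishing denominator.\<close>

lemma continuous_on_act:
  assumes g: "g \<in> carrier SU21"
  shows "continuous_on Ptilde (act g)"
proof -
  have "(g *v homog (fst p))$3 \<noteq> 0" if "p \<in> Ptilde" for p
    using herm_homog_Ptilde[OF that] g by (intro herm_neg_third) (simp add: herm_mult_U21 carrier_SU21)
  moreover have "continuous_on Ptilde (\<lambda>p. (g *v homog (fst p))$i)" for i
    by (simp add: matrix_vector_mult_3) (intro continuous_intros)
  ultimately have "continuous_on Ptilde (\<lambda>p. proj_pt (g *v homog (fst p)) (snd p))"
    unfolding proj_pt_def by (intro continuous_on_Pair continuous_on_vector_2 continuous_on_divide
        continuous_on_power continuous_on_snd continuous_on_id) auto
  then show ?thesis
    by (rule continuous_on_cong[THEN iffD1, rotated -1]) (simp_all add: act_eq_proj_pt g)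
qed

subsection \<open>Orbit spaces\<close>

text \<open>The group carries no topology: it is treated as discrete, with one continuous map for
  each element.\<close>

locale continuous_action =
  fixes G :: "('g, 'm) monoid_scheme" and E :: "'b::topological_space set"
    and \<phi> :: "'g \<Rightarrow> 'b \<Rightarrow> 'b"
  assumes group_G: "group G"
    and action_closed: "\<And>g x. g \<in> carrier G \<Longrightarrow> x \<in> E \<Longrightarrow> \<phi> g x \<in> E"
    and action_one: "\<And>x. x \<in> E \<Longrightarrow> \<phi> \<one>\<^bsub>G\<^esub> x = x"
    and action_mult: "\<And>g h x. g \<in> carrier G \<Longrightarrow> h \<in> carrier G \<Longrightarrow> x \<in> E \<Longrightarrow>
      \<phi> (g \<otimes>\<^bsub>G\<^esub> h) x = \<phi> g (\<phi> h x)"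
    and continuous_action: "\<And>g. g \<in> carrier G \<Longrightarrow> continuous_on E (\<phi> g)"
begin

lemma orbit_self: "x \<in> E \<Longrightarrow> x \<in> orbit G \<phi> x"
  unfolding orbit_def using action_one[of x] monoid.one_closed[OF group.is_monoid[OF group_G]]
  by (metis (mono_tags, lifting) mem_Collect_eq)

lemma orbit_action:
  assumes "g \<in> carrier G" "x \<in> E"
  shows "orbit G \<phi> (\<phi> g x) = orbit G \<phi> x"
proof
  interpret group G by (rule group_G)
  show "orbit G \<phi> (\<phi> g x) \<subseteq> orbit G \<phi> x"
    unfolding orbit_def using assms action_mult[OF _ assms, symmetric] m_closed by blast
  have "\<phi> h x = \<phi> (h \<otimes>\<^bsub>G\<^esub> inv\<^bsub>G\<^esub> g) (\<phi> g x)" if "h \<in> carrier G" for h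
    using assms that action_mult[of "h \<otimes>\<^bsub>G\<^esub> inv\<^bsub>G\<^esub> g" g x] by (simp add: m_assoc)
  then show "orbit G \<phi> x \<subseteq> orbit G \<phi> (\<phi> g x)"
    using assms unfolding orbit_def by blast
qed

lemma orbit_eq_iff:
  assumes "x \<in> E" "y \<in> E"
  shows "orbit G \<phi> x = orbit G \<phi> y \<longleftrightarrow> (\<exists>g\<in>carrier G. y = \<phi> g x)"
proof
  assume "orbit G \<phi> x = orbit G \<phi> y"
  then have "y \<in> orbit G \<phi> x"
    using orbit_self[OF assms(2)] by simp
  then show "\<exists>g\<in>carrier G. y = \<phi> g x"
    by (auto simp: orbit_def)
qed (use assms orbit_action in auto)

text \<open>The saturation of an open set is the union of its preimages under all group
  elements.\<close>

lemma open_map_orbit: "open_map (top_of_set E) (orbit_space G E \<phi>) (orbit G \<phi>)"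
  unfolding open_map_def openin_orbit_space
proof (intro allI impI conjI)
  fix U assume U: "openin (top_of_set E) U"
  then have "U \<subseteq> E"
    by (simp add: openin_imp_subset)
  then show "orbit G \<phi> ` U \<subseteq> orbits G E \<phi>"
    by (auto simp: orbits_def)
  have "{x \<in> E. orbit G \<phi> x \<in> orbit G \<phi> ` U} = (\<Union>g\<in>carrier G. E \<inter> \<phi> g -` U)"
  proof (intro equalityI subsetI)
    fix x assume "x \<in> {x \<in> E. orbit G \<phi> x \<in> orbit G \<phi> ` U}"
    then obtain u where u: "x \<in> E" "u \<in> U" "orbit G \<phi> x = orbit G \<phi> u"
      by blast
    then show "x \<in> (\<Union>g\<in>carrier G. E \<inter> \<phi> g -` U)"
      using orbit_eq_iff[of x u] \<open>U \<subseteq> E\<close> by auto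
  next
    fix x assume "x \<in> (\<Union>g\<in>carrier G. E \<inter> \<phi> g -` U)"
    then obtain g where g: "g \<in> carrier G" "x \<in> E" "\<phi> g x \<in> U"
      by blast
    then show "x \<in> {x \<in> E. orbit G \<phi> x \<in> orbit G \<phi> ` U}"
      using orbit_action[of g x] by (auto intro: rev_image_eqI)
  qed
  moreover have "openin (top_of_set E) (E \<inter> \<phi> g -` U)" if "g \<in> carrier G" for g
    using continuous_action[OF that] U action_closed[OF that]
    by (intro continuous_openin_preimage) auto
  then have "openin (top_of_set E) (\<Union>g\<in>carrier G. E \<inter> \<phi> g -` U)"
    by (intro openin_Union) blast
  ultimately show "openin (top_of_set E) {x \<in> E. orbit G \<phi> x \<in> orbit G \<phi> ` U}"
    by (simp only:)
qed

lemma Hausdorff_orbit_space: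
  assumes "\<And>x y. x \<in> E \<Longrightarrow> y \<in> E \<Longrightarrow> y \<notin> orbit G \<phi> x \<Longrightarrow>
    \<exists>U V. openin (top_of_set E) U \<and> openin (top_of_set E) V \<and> x \<in> U \<and> y \<in> V \<and>
      (\<forall>u\<in>U. \<forall>v\<in>V. v \<notin> orbit G \<phi> u)"
  shows "Hausdorff_space (orbit_space G E \<phi>)"
  unfolding Hausdorff_space_def topspace_orbit_space
proof (intro allI impI, elim conjE)
  fix P Q assume "P \<in> orbits G E \<phi>" "Q \<in> orbits G E \<phi>" and ne: "P \<noteq> Q"
  then obtain x y where x: "x \<in> E" "P = orbit G \<phi> x" and y: "y \<in> E" "Q = orbit G \<phi> y"
    unfolding orbits_def by blast
  have "y \<notin> orbit G \<phi> x"
    using ne orbit_action[OF _ x(1)] unfolding x(2) y(2) by (fastforce simp: orbit_def[of G \<phi> x])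
  then obtain U V where UV: "openin (top_of_set E) U" "openin (top_of_set E) V" "x \<in> U" "y \<in> V"
      "\<forall>u\<in>U. \<forall>v\<in>V. v \<notin> orbit G \<phi> u"
    using assms[OF x(1) y(1)] by blast
  have "disjnt (orbit G \<phi> ` U) (orbit G \<phi> ` V)"
    unfolding disjnt_iff
  proof (intro allI notI, elim conjE imageE)
    fix R u v assume uv: "u \<in> U" "v \<in> V" and R: "R = orbit G \<phi> u" "R = orbit G \<phi> v"
    have "v \<in> E"
      using openin_imp_subset[OF UV(2)] uv by auto
    then have "v \<in> orbit G \<phi> u"
      using orbit_self[of v] R by simp
    then show False
      using UV(5) uv by blast
  qed
  moreover have "openin (orbit_space G E \<phi>) (orbit G \<phi> ` U)" "openin (orbit_space G E \<phi>) (orbit G \<phi> ` V)"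
    using UV open_map_orbit by (simp_all add: open_map_def)
  moreover have "P \<in> orbit G \<phi> ` U" "Q \<in> orbit G \<phi> ` V"
    using x y UV by simp_all
  ultimately show "\<exists>U V. openin (orbit_space G E \<phi>) U \<and> openin (orbit_space G E \<phi>) V \<and>
      P \<in> U \<and> Q \<in> V \<and> disjnt U V"
    by blast
qed

text \<open>If \<open>t\<close> is translated by \<open>n T\<close>, an element mapping a point near \<open>x\<close> to a point near \<open>y\<close>
  has a fixed index \<open>n\<close>, namely the integer closest to \<open>(t y - t x) / T\<close>.\<close>

lemma Hausdorff_orbit_space_translation:
  fixes t :: "'b \<Rightarrow> real" and a :: "int \<Rightarrow> 'g"
  assumes G: "carrier G = range a" and T: "T > 0"
    and t: "continuous_on E t" "\<And>n x. x \<in> E \<Longrightarrow> t (\<phi> (a n) x) = t x + of_int n * T"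
    and E: "\<And>x y. x \<in> E \<Longrightarrow> y \<in> E \<Longrightarrow> x \<noteq> y \<Longrightarrow> \<exists>U V. open U \<and> open V \<and> x \<in> U \<and> y \<in> V \<and> U \<inter> V = {}"
  shows "Hausdorff_space (orbit_space G E \<phi>)"
proof (rule Hausdorff_orbit_space)
  fix x y assume x: "x \<in> E" and y: "y \<in> E" and ne: "y \<notin> orbit G \<phi> x"
  define m where "m = round ((t y - t x) / T)"
  have am: "a m \<in> carrier G"
    by (simp add: G)
  have "\<phi> (a m) x \<noteq> y"
    using ne am by (auto simp: orbit_def)
  then obtain A B where AB: "open A" "open B" "\<phi> (a m) x \<in> A" "y \<in> B" "A \<inter> B = {}"
    using E action_closed[OF am x] y by metis
  \<comment> \<open>A margin of \<open>T/4\<close> around each of the two values keeps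
    \<open>of_int n * T\<close> within \<open>T/2\<close> of \<open>t y - t x\<close>, which leaves
    \<open>m\<close> as the only possible index.\<close>
  define U where "U = (E \<inter> t -` {t x - T/4 <..< t x + T/4}) \<inter> (E \<inter> \<phi> (a m) -` A)"
  define V where "V = (E \<inter> t -` {t y - T/4 <..< t y + T/4}) \<inter> (E \<inter> B)"
  have "openin (top_of_set E) U" "openin (top_of_set E) V"
    unfolding U_def V_def using AB
    by (intro openin_Int continuous_openin_preimage_gen[OF t(1)]
        continuous_openin_preimage_gen[OF continuous_action[OF am]] openin_open_Int
        open_greaterThanLessThan; simp)+
  moreover have "x \<in> U" "y \<in> V"
    using x y AB T by (auto simp: U_def V_def)
  moreover have "v \<notin> orbit G \<phi> u" if u: "u \<in> U" and v: "v \<in> V" for u v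
  proof
    assume "v \<in> orbit G \<phi> u"
    then obtain n where n: "v = \<phi> (a n) u"
      by (auto simp: orbit_def G)
    then have "t v = t u + of_int n * T"
      using t(2) u by (auto simp: U_def)
    then have "\<bar>of_int n * T - (t y - t x)\<bar> < T / 2"
      using u v by (auto simp: U_def V_def abs_if)
    then have "\<bar>(of_int n * T - (t y - t x)) / T\<bar> < 1 / 2"
      using T by (simp add: field_simps)
    also have "(of_int n * T - (t y - t x)) / T = of_int n - (t y - t x) / T"
      using T by (simp add: field_simps)
    finally have "m = n"
      unfolding m_def by (intro round_unique') (simp add: abs_minus_commute)
    then show False
      using n u v AB by (auto simp: U_def V_def)
  qed
  ultimately show "\<exists>U V. openin (top_of_set E) U \<and> openin (top_of_set E) V \<and> x \<in> U \<and> y \<in> V \<and>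
      (\<forall>u\<in>U. \<forall>v\<in>V. v \<notin> orbit G \<phi> u)"
    by blast
qed

text \<open>\<open>L\<close> itself may fail to be invariant, so openness is measured in an
  invariant set \<open>S\<close> containing it. A point of \<open>O'\<close> on the orbit of a point
  of \<open>L\<close> lies in \<open>S\<close>, hence in \<open>U\<close>. In the application
  \<open>L\<close> is the surface and \<open>S\<close> the union of its two sheets.\<close>

lemma openin_orbit_image:
  assumes S: "S \<subseteq> E" "\<And>g x. g \<in> carrier G \<Longrightarrow> x \<in> S \<Longrightarrow> \<phi> g x \<in> S"
    and L: "L \<subseteq> S" "U \<subseteq> L" and U: "openin (top_of_set S) U"
  shows "openin (subtopology (orbit_space G E \<phi>) (orbit G \<phi> ` L)) (orbit G \<phi> ` U)"
proof -
  obtain O' where O': "open O'" "U = S \<inter> O'"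
    using U by (auto simp: openin_open)
  have "orbit G \<phi> ` U = orbit G \<phi> ` (E \<inter> O') \<inter> orbit G \<phi> ` L"
  proof (intro equalityI subsetI)
    fix Q assume "Q \<in> orbit G \<phi> ` (E \<inter> O') \<inter> orbit G \<phi> ` L"
    then obtain x y where xy: "x \<in> E" "x \<in> O'" "y \<in> L" "Q = orbit G \<phi> x" "Q = orbit G \<phi> y"
      by auto
    then have "y \<in> S" "y \<in> E"
      using S L by auto
    then obtain g where "g \<in> carrier G" "x = \<phi> g y"
      using xy orbit_eq_iff[of y x] by auto
    then have "x \<in> U"
      using S(2) \<open>y \<in> S\<close> xy O' by auto
    then show "Q \<in> orbit G \<phi> ` U"
      using xy by auto
  qed (use S L O' in auto)
  moreover have "openin (orbit_space G E \<phi>) (orbit G \<phi> ` (E \<inter> O'))"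
    using open_map_orbit O'(1) unfolding open_map_def by (simp add: openin_open_Int)
  ultimately show ?thesis
    by (auto simp: openin_subtopology)
qed

text \<open>This turns a parametrization upstairs into a chart of the quotient: \<open>F\<close> is
  open onto its image in \<open>S\<close> and meets each orbit at most once, so its composite with
  the orbit map is continuous, open and injective.\<close>

lemma homeomorphic_map_orbit_local_section:
  fixes F :: "'c::topological_space \<Rightarrow> 'b"
  assumes S: "S \<subseteq> E" "\<And>g x. g \<in> carrier G \<Longrightarrow> x \<in> S \<Longrightarrow> \<phi> g x \<in> S"
    and L: "L \<subseteq> S" and F: "F ` W \<subseteq> L" "continuous_on W F"
    and op: "\<And>W'. open W' \<Longrightarrow> openin (top_of_set S) (F ` (W \<inter> W'))"
    and inj: "inj_on (\<lambda>x. orbit G \<phi> (F x)) W"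
  defines "N \<equiv> subtopology (orbit_space G E \<phi>) (orbit G \<phi> ` L)"
    and "h \<equiv> \<lambda>x. orbit G \<phi> (F x)"
  shows "openin N (h ` W)" "homeomorphic_map (top_of_set W) (subtopology N (h ` W)) h"
proof -
  have h_open: "openin N (h ` (W \<inter> W'))" if "open W'" for W'
  proof -
    have "F ` (W \<inter> W') \<subseteq> L"
      using F(1) by auto
    then show ?thesis
      using openin_orbit_image[OF S L _ op[OF that]] by (simp add: N_def h_def image_image)
  qed
  then show hW: "openin N (h ` W)"
    by (metis Int_UNIV_right open_UNIV)
  show "homeomorphic_map (top_of_set W) (subtopology N (h ` W)) h"
  proof (rule bijective_open_imp_homeomorphic_map)
    have "F ` W \<subseteq> E"
      using F(1) S(1) L by blast
    then have "continuous_map (top_of_set W) (top_of_set E) F"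
      using F(2) by auto
    then have "continuous_map (top_of_set W) (orbit_space G E \<phi>) h"
      unfolding h_def
      using continuous_map_compose[OF _ quotient_imp_continuous_map[OF quotient_map_orbit_space]]
      by (simp only: comp_def)
    then show "continuous_map (top_of_set W) (subtopology N (h ` W)) h"
      unfolding N_def subtopology_subtopology continuous_map_in_subtopology using F(1)
      by (auto simp: h_def)
    show "open_map (top_of_set W) (subtopology N (h ` W)) h"
      unfolding open_map_def
    proof (intro allI impI)
      fix U assume "openin (top_of_set W) U"
      then obtain W' where "open W'" "U = W \<inter> W'"
        by (auto simp: openin_open)
      then show "openin (subtopology N (h ` W)) (h ` U)"
        using h_open hW by (auto simp: openin_open_subtopology)
    qed
    show "h ` topspace (top_of_set W) = topspace (subtopology N (h ` W))"
      using openin_subset[OF hW] by auto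
    show "inj_on h (topspace (top_of_set W))"
      using inj by (simp add: h_def)
  qed
qed

lemma second_countable_orbit_space:
  assumes "second_countable (top_of_set E)"
  shows "second_countable (orbit_space G E \<phi>)"
  using second_countable_open_map_image[OF quotient_imp_continuous_map[OF quotient_map_orbit_space]
      open_map_orbit] assms quotient_imp_surjective_map[OF quotient_map_orbit_space] by blast

end

subsection \<open>Functions of class Ck\<close>

text \<open>\<open>frechet_derivative\<close> is taken at points of the whole space; since
  \<open>U\<close> is open, functions that agree on \<open>U\<close> have the same derivatives
  there.\<close>

lemma Ck_on_cong:
  assumes "open U" "\<And>x. x \<in> U \<Longrightarrow> f x = g x" "Ck_on n U f"
  shows "Ck_on n U g"
  using assms(2,3)
proof (induction n arbitrary: f g)
  case 0
  then show ?case
    by (simp cong: continuous_on_cong)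
next
  case (Suc n)
  have f: "f differentiable (at x)" if "x \<in> U" for x
    using Suc.prems(2) that by simp
  have D: "(g has_derivative frechet_derivative f (at x)) (at x)" if x: "x \<in> U" for x
    using f[OF x] Suc.prems(1) unfolding frechet_derivative_works
    by (rule has_derivative_transform_within_open[OF _ \<open>open U\<close> x])
  have "frechet_derivative f (at x) v = frechet_derivative g (at x) v" if "x \<in> U" for x v
    using frechet_derivative_at[OF D[OF that]] by (rule fun_cong)
  moreover have "Ck_on n U (\<lambda>x. frechet_derivative f (at x) v)" for v
    using Suc.prems(2) by simp
  ultimately have "Ck_on n U (\<lambda>x. frechet_derivative g (at x) v)" for v
    by (rule Suc.IH)
  with D show ?case
    unfolding Ck_on.simps differentiable_def by blast
qed

text \<open>Any explicit formula for the derivative may replace \<open>frechet_derivative\<close>,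
  which makes the inductions on the order below possible.\<close>

lemma Ck_on_SucI:
  assumes "open U" and D: "\<And>x. x \<in> U \<Longrightarrow> (f has_derivative D x) (at x)"
    and "\<And>v. Ck_on n U (\<lambda>x. D x v)"
  shows "Ck_on (Suc n) U f"
proof -
  have "Ck_on n U (\<lambda>x. frechet_derivative f (at x) v)" for v
    using frechet_derivative_at[OF D] assms by (intro Ck_on_cong[OF _ _ assms(3)[of v]]) auto
  with D show ?thesis
    by (auto simp: differentiable_def)
qed

lemma Ck_on_has_derivative:
  "Ck_on (Suc n) U f \<Longrightarrow> x \<in> U \<Longrightarrow> (f has_derivative frechet_derivative f (at x)) (at x)"
  by (simp add: frechet_derivative_works)

lemma Ck_on_frechet_derivative:
  "Ck_on (Suc n) U f \<Longrightarrow> Ck_on n U (\<lambda>x. frechet_derivative f (at x) v)"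
  by simp

lemma Ck_on_SucD: "Ck_on (Suc n) U f \<Longrightarrow> Ck_on n U f"
proof (induction n arbitrary: f)
  case 0
  then show ?case
    by (auto intro!: continuous_at_imp_continuous_on differentiable_imp_continuous_within)
next
  case (Suc n)
  have "Ck_on n U (\<lambda>x. frechet_derivative f (at x) v)" for v
    by (intro Suc.IH Ck_on_frechet_derivative[OF Suc.prems])
  with Suc.prems show ?case
    by (simp only: Ck_on.simps(2)) blast
qed

lemma Ck_on_const: "open U \<Longrightarrow> Ck_on n U (\<lambda>x. c)"
  by (induction n arbitrary: c)
    (simp, intro Ck_on_SucI[where D = "\<lambda>x v. 0"] has_derivative_const)

lemma Ck_on_linear: "open U \<Longrightarrow> bounded_linear f \<Longrightarrow> Ck_on n U f"
  by (cases n)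
    (auto intro!: Ck_on_SucI[where D = "\<lambda>x. f"] Ck_on_const linear_continuous_on
      bounded_linear_imp_has_derivative simp del: Ck_on.simps(2))

text \<open>Linear images, sums, products, inverses and exponentials are the operations from which
  the parametrization of the surface is built.\<close>

lemma Ck_on_linear_compose:
  assumes "open U" "bounded_linear L" "Ck_on n U f"
  shows "Ck_on n U (\<lambda>x. L (f x))"
  using assms(3)
proof (induction n arbitrary: f)
  case 0
  then show ?case
    by (auto intro: bounded_linear.continuous_on[OF assms(2)])
next
  case (Suc n)
  define D where "D x = frechet_derivative f (at x)" for x
  have D: "\<And>x. x \<in> U \<Longrightarrow> (f has_derivative D x) (at x)" "\<And>v. Ck_on n U (\<lambda>x. D x v)"
    unfolding D_def by (rule Ck_on_has_derivative[OF Suc.prems] Ck_on_frechet_derivative[OF Suc.prems]; assumption)+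
  then show ?case
    by (intro Ck_on_SucI[where D = "\<lambda>x v. L (D x v)"] assms(1)
        bounded_linear.has_derivative[OF assms(2)] Suc.IH)
qed

lemma Ck_on_add:
  assumes "open U" "Ck_on n U f" "Ck_on n U g"
  shows "Ck_on n U (\<lambda>x. f x + g x)"
  using assms(2,3)
proof (induction n arbitrary: f g)
  case 0
  then show ?case
    by (auto intro: continuous_on_add)
next
  case (Suc n)
  define D where "D x = frechet_derivative f (at x)" for x
  have D: "\<And>x. x \<in> U \<Longrightarrow> (f has_derivative D x) (at x)" "\<And>v. Ck_on n U (\<lambda>x. D x v)"
    unfolding D_def by (rule Ck_on_has_derivative[OF Suc.prems(1)] Ck_on_frechet_derivative[OF Suc.prems(1)]; assumption)+
  define E where "E x = frechet_derivative g (at x)" for x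
  have E: "\<And>x. x \<in> U \<Longrightarrow> (g has_derivative E x) (at x)" "\<And>v. Ck_on n U (\<lambda>x. E x v)"
    unfolding E_def by (rule Ck_on_has_derivative[OF Suc.prems(2)] Ck_on_frechet_derivative[OF Suc.prems(2)]; assumption)+
  show ?case
    using D E Suc.IH by (intro Ck_on_SucI[where D = "\<lambda>x v. D x v + E x v"] assms(1) has_derivative_add) auto
qed

lemma Ck_on_mult:
  fixes f g :: "'a::euclidean_space \<Rightarrow> 'b::{euclidean_space, real_normed_algebra}"
  assumes "open U" "Ck_on n U f" "Ck_on n U g"
  shows "Ck_on n U (\<lambda>x. f x * g x)"
  using assms(2,3)
proof (induction n arbitrary: f g)
  case 0
  then show ?case
    by (auto intro: continuous_on_mult)
next
  case (Suc n)
  define D where "D x = frechet_derivative f (at x)" for x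
  have D: "\<And>x. x \<in> U \<Longrightarrow> (f has_derivative D x) (at x)" "\<And>v. Ck_on n U (\<lambda>x. D x v)"
    unfolding D_def by (rule Ck_on_has_derivative[OF Suc.prems(1)] Ck_on_frechet_derivative[OF Suc.prems(1)]; assumption)+
  define E where "E x = frechet_derivative g (at x)" for x
  have E: "\<And>x. x \<in> U \<Longrightarrow> (g has_derivative E x) (at x)" "\<And>v. Ck_on n U (\<lambda>x. E x v)"
    unfolding E_def by (rule Ck_on_has_derivative[OF Suc.prems(2)] Ck_on_frechet_derivative[OF Suc.prems(2)]; assumption)+
  show ?case
    \<comment> \<open>The Leibniz formula contains the factors themselves next to their derivatives,
      so their order is lowered by one with \<open>Ck_on_SucD\<close> before the induction
      hypothesis applies.\<close>
    by (intro Ck_on_SucI[where D = "\<lambda>x v. f x * E x v + D x v * g x"] Ck_on_add assms(1)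
        has_derivative_mult Suc.IH Suc.prems[THEN Ck_on_SucD] D E)
qed

text \<open>The derivative is a product that contains the same inverse again, but only one order
  less is asked of it, so the induction closes. The exponential is treated in the same way.\<close>

lemma Ck_on_inverse:
  fixes f :: "'a::euclidean_space \<Rightarrow> 'b::{euclidean_space, real_normed_div_algebra}"
  assumes "open U" "Ck_on n U f" "\<And>x. x \<in> U \<Longrightarrow> f x \<noteq> 0"
  shows "Ck_on n U (\<lambda>x. inverse (f x))"
  using assms(2)
proof (induction n)
  case 0
  then show ?case
    using assms(3) by (auto intro: continuous_on_inverse)
next
  case (Suc n)
  define D where "D x = frechet_derivative f (at x)" for x
  have D: "\<And>x. x \<in> U \<Longrightarrow> (f has_derivative D x) (at x)" "\<And>v. Ck_on n U (\<lambda>x. D x v)"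
    unfolding D_def by (rule Ck_on_has_derivative[OF Suc.prems] Ck_on_frechet_derivative[OF Suc.prems]; assumption)+
  have "Ck_on n U (\<lambda>x. - (inverse (f x) * D x v * inverse (f x)))" for v
    by (intro Ck_on_linear_compose[OF assms(1) bounded_linear_minus[OF bounded_linear_ident]]
        Ck_on_mult assms(1) D(2) Suc.IH Ck_on_SucD[OF Suc.prems])
  then show ?case
    using D(1) assms(3)
    by (intro Ck_on_SucI[where D = "\<lambda>x v. - (inverse (f x) * D x v * inverse (f x))"] assms(1)
        Deriv.has_derivative_inverse) auto
qed

lemma Ck_on_exp:
  fixes f :: "'a::euclidean_space \<Rightarrow> complex"
  assumes "open U" "Ck_on n U f"
  shows "Ck_on n U (\<lambda>x. exp (f x))"
  using assms(2)
proof (induction n)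
  case 0
  then show ?case
    by (auto intro: continuous_on_exp)
next
  case (Suc n)
  define D where "D x = frechet_derivative f (at x)" for x
  have D: "\<And>x. x \<in> U \<Longrightarrow> (f has_derivative D x) (at x)" "\<And>v. Ck_on n U (\<lambda>x. D x v)"
    unfolding D_def by (rule Ck_on_has_derivative[OF Suc.prems] Ck_on_frechet_derivative[OF Suc.prems]; assumption)+
  have "Ck_on n U (\<lambda>x. exp (f x) * D x v)" for v
    by (intro Ck_on_mult assms(1) D(2) Suc.IH Ck_on_SucD[OF Suc.prems])
  then show ?case
    using has_derivative_compose[OF D(1) DERIV_exp[unfolded has_field_derivative_def]]
    by (intro Ck_on_SucI[where D = "\<lambda>x v. exp (f x) * D x v"] assms(1))
qed

subsection \<open>Derivatives of vector-valued functions\<close>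

lemma bounded_linear_vector_2:
  "bounded_linear (\<lambda>p :: 'a::euclidean_space \<times> 'a. vector [fst p, snd p] :: 'a^2)"
  unfolding linear_conv_bounded_linear[symmetric]
  by (rule linearI) (simp_all add: vec_eq_iff forall_2)

lemma bounded_linear_vector_3:
  "bounded_linear (\<lambda>p :: 'a::euclidean_space \<times> 'a \<times> 'a. vector [fst p, fst (snd p), snd (snd p)] :: 'a^3)"
  unfolding linear_conv_bounded_linear[symmetric]
  by (rule linearI) (simp_all add: vec_eq_iff forall_3)

lemma has_derivative_vector_2:
  fixes f g :: "'b::real_normed_vector \<Rightarrow> 'a::euclidean_space"
  assumes "(f has_derivative f') (at x within S)" "(g has_derivative g') (at x within S)"
  shows "((\<lambda>x. vector [f x, g x] :: 'a^2) has_derivative (\<lambda>v. vector [f' v, g' v])) (at x within S)"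
  using bounded_linear.has_derivative[OF bounded_linear_vector_2 has_derivative_Pair[OF assms]]
  by simp

lemma has_derivative_vector_3:
  fixes f g h :: "'b::real_normed_vector \<Rightarrow> 'a::euclidean_space"
  assumes "(f has_derivative f') (at x within S)" "(g has_derivative g') (at x within S)" "(h has_derivative h') (at x within S)"
  shows "((\<lambda>x. vector [f x, g x, h x] :: 'a^3) has_derivative (\<lambda>v. vector [f' v, g' v, h' v])) (at x within S)"
  using bounded_linear.has_derivative[OF bounded_linear_vector_3
      has_derivative_Pair[OF assms(1) has_derivative_Pair[OF assms(2,3)]]]
  by simp

lemma bounded_linear_matrix_vector_mult:
  fixes A :: "complex^'n^'m"
  shows "bounded_linear ((*v) A)"
  unfolding linear_conv_bounded_linear[symmetric]
  by (rule linearI)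
    (simp_all add: matrix_vector_right_distrib vec_eq_iff matrix_vector_mult_def scaleR_sum_right
      distrib_left sum.distrib)

subsection \<open>The contact form in homogeneous coordinates\<close>

text \<open>The (1,0)-part of the differential of \<open>ln (rho w)\<close> in the direction
  \<open>u\<close> is the Hermitian product of \<open>u\<close> and \<open>z\<close> divided by
  \<open>herm (homog z) (homog z)\<close>; the third coordinate of a tangent vector of the affine
  chart is 0.\<close>

lemma contact_form_eq:
  assumes "z \<in> Ball2"
  shows "contact_form (z, \<zeta>) (u, \<tau>) =
    \<i> * (\<tau> / \<zeta> - 3 * (u$1 * cnj (z$1) + u$2 * cnj (z$2)) / herm (homog z) (homog z))"
proof -
  define s where "s = u$1 * cnj (z$1) + u$2 * cnj (z$2)"
  define D :: "complex^2 \<Rightarrow> complex" where "D v = of_real (- 2 * (z \<bullet> v) / rho z)" for v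
  have rho: "rho z > 0"
    using assms unfolding Ball2_iff .
  have "((\<lambda>w. ln (1 - w \<bullet> w)) has_derivative (\<lambda>v. - 2 * (z \<bullet> v) / rho z)) (at z)"
    using rho
    by (auto intro!: derivative_eq_intros simp: rho_eq_norm power2_norm_eq_inner inner_commute field_simps)
  then have "((\<lambda>w. complex_of_real (ln (rho w))) has_derivative D) (at z)"
    unfolding D_def rho_eq_norm power2_norm_eq_inner by (rule has_derivative_of_real)
  then have fd: "frechet_derivative (\<lambda>w. complex_of_real (ln (rho w))) (at z) = D"
    by (metis frechet_derivative_at)
  \<comment> \<open>The real differential sees only the real part of \<open>s\<close>. Replacing
    \<open>u\<close> by \<open>\<i> *s u\<close> replaces \<open>s\<close> by
    \<open>\<i> * s\<close>, whose real part is minus the imaginary part of \<open>s\<close>;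
    \<open>del\<close> reassembles the two.\<close>
  have D: "D u = - 2 * of_real (Re s) / of_real (rho z)" "D (\<i> *s u) = 2 * of_real (Im s) / of_real (rho z)"
    by (simp_all add: D_def s_def inner_vec_def sum_2 inner_complex_def algebra_simps)
  have "del (\<lambda>w. of_real (ln (rho w))) z u = - (of_real (Re s) + \<i> * of_real (Im s)) / of_real (rho z)"
    unfolding del_def fd D using rho by (simp add: field_simps)
  also have "of_real (Re s) + \<i> * of_real (Im s) = s"
    by (rule complex_eq[symmetric])
  also have "of_real (rho z) = - herm (homog z) (homog z)"
    unfolding rho_def of_real_minus herm_self[symmetric] ..
  finally have "del (\<lambda>w. of_real (ln (rho w))) z u = s / herm (homog z) (homog z)"
    by simp
  then show ?thesis
    unfolding contact_form_def theta_form_def s_def[symmetric] by (simp add: right_diff_distrib)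
qed

text \<open>The quotient rule, with the terms grouped so that \<open>contact_form_proj_pt\<close>
  applies to the result literally.\<close>

lemma has_derivative_proj_pt:
  assumes Z: "(Z has_derivative Z') (at x)" and \<eta>: "(\<eta> has_derivative \<eta>') (at x)"
    and nz: "Z x $ 3 \<noteq> 0"
  shows "((\<lambda>x. proj_pt (Z x) (\<eta> x)) has_derivative
    (\<lambda>v. (vector [(Z' v $ 1 - Z x $ 1 / Z x $ 3 * Z' v $ 3) / Z x $ 3,
                  (Z' v $ 2 - Z x $ 2 / Z x $ 3 * Z' v $ 3) / Z x $ 3],
          (\<eta>' v - 3 * \<eta> x * Z' v $ 3 / Z x $ 3) / Z x $ 3 ^ 3))) (at x)"
  unfolding proj_pt_def
proof (intro has_derivative_Pair has_derivative_vector_2)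
  have Zi: "((\<lambda>x. Z x $ i) has_derivative (\<lambda>v. Z' v $ i)) (at x)" for i
    by (rule bounded_linear.has_derivative[OF bounded_linear_vec_nth Z])
  have quot: "((\<lambda>x. Z x $ i / Z x $ 3) has_derivative
      (\<lambda>v. (Z' v $ i - Z x $ i / Z x $ 3 * Z' v $ 3) / Z x $ 3)) (at x)" for i
    using nz by (auto intro!: has_derivative_eq_rhs[OF has_derivative_divide[OF Zi Zi]] simp: field_simps)
  show "((\<lambda>x. Z x $ 1 / Z x $ 3) has_derivative
      (\<lambda>v. (Z' v $ 1 - Z x $ 1 / Z x $ 3 * Z' v $ 3) / Z x $ 3)) (at x)"
    "((\<lambda>x. Z x $ 2 / Z x $ 3) has_derivative
      (\<lambda>v. (Z' v $ 2 - Z x $ 2 / Z x $ 3 * Z' v $ 3) / Z x $ 3)) (at x)"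
    by (rule quot)+
  show "((\<lambda>x. \<eta> x / Z x $ 3 ^ 3) has_derivative
      (\<lambda>v. (\<eta>' v - 3 * \<eta> x * Z' v $ 3 / Z x $ 3) / Z x $ 3 ^ 3)) (at x)"
    by (rule has_derivative_eq_rhs[OF has_derivative_divide[OF \<eta> has_derivative_power[OF Zi]]])
      (use nz in \<open>auto simp: fun_eq_iff field_simps power2_eq_square power3_eq_cube\<close>)
qed

text \<open>Base and fibre each contribute a term in \<open>Z' $ 3 / Z $ 3\<close> with coefficient
  3, and the two cancel. What remains involves \<open>Z\<close> only through the Hermitian
  form.\<close>

lemma contact_form_proj_pt:
  assumes neg: "Re (herm Z Z) < 0" and "\<eta> \<noteq> 0"
  shows "contact_form (proj_pt Z \<eta>)
      (vector [(Z' $ 1 - Z $ 1 / Z $ 3 * Z' $ 3) / Z $ 3, (Z' $ 2 - Z $ 2 / Z $ 3 * Z' $ 3) / Z $ 3],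
       (\<eta>' - 3 * \<eta> * Z' $ 3 / Z $ 3) / Z $ 3 ^ 3)
    = \<i> * (\<eta>' / \<eta> - 3 * herm Z' Z / herm Z Z)"
proof -
  define z where "z = fst (proj_pt Z \<eta>)"
  have nz: "Z$3 \<noteq> 0"
    by (rule herm_neg_third[OF neg])
  have zi: "z$1 = Z$1 / Z$3" "z$2 = Z$2 / Z$3"
    by (simp_all add: z_def proj_pt_def)
  have hnz: "herm Z Z \<noteq> 0"
    using neg by auto
  have "rho z > 0"
    unfolding z_def rho_proj_pt[OF nz] using neg nz by (simp add: divide_neg_pos)
  then have z: "z \<in> Ball2"
    unfolding Ball2_iff .
  have hz: "herm (homog z) (homog z) = herm Z Z / (Z$3 * cnj (Z$3))"
    using nz by (simp add: herm_def zi field_simps)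
  have "(Z'$1 - z$1 * Z'$3) / Z$3 * cnj (z$1) + (Z'$2 - z$2 * Z'$3) / Z$3 * cnj (z$2)
      = (herm Z' Z - herm Z Z * Z'$3 / Z$3) / (Z$3 * cnj (Z$3))"
    using nz by (simp add: herm_def zi field_simps)
  also have "\<dots> / herm (homog z) (homog z) = herm Z' Z / herm Z Z - Z'$3 / Z$3"
    unfolding hz using nz hnz by (simp add: field_simps)
  finally have "((Z'$1 - z$1 * Z'$3) / Z$3 * cnj (z$1) + (Z'$2 - z$2 * Z'$3) / Z$3 * cnj (z$2))
      / herm (homog z) (homog z) = herm Z' Z / herm Z Z - Z'$3 / Z$3" .
  moreover have "(\<eta>' - 3 * \<eta> * Z' $ 3 / Z $ 3) / Z $ 3 ^ 3 / (\<eta> / Z$3 ^ 3) = \<eta>' / \<eta> - 3 * Z'$3 / Z$3"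
    using nz assms(2) by (simp add: field_simps)
  moreover have "proj_pt Z \<eta> = (z, \<eta> / Z$3 ^ 3)"
    by (simp add: z_def proj_pt_def)
  ultimately show ?thesis
    by (simp only: contact_form_eq[OF z] vector_2 zi(1)[symmetric] zi(2)[symmetric]
        times_divide_eq_right[symmetric]) (simp add: algebra_simps)
qed

subsection \<open>The surface and the cyclic group\<close>

interpretation SU21: group SU21
  by (rule group_SU21)

lemma cyclic_eq: "\<gamma> \<in> carrier SU21 \<Longrightarrow> cyclic \<gamma> = range (\<lambda>n::int. \<gamma> [^]\<^bsub>SU21\<^esub> n)"
  unfolding cyclic_def by (simp add: SU21.generate_pow full_SetCompr_eq)

lemma act_int_pow:
  fixes n m :: int
  assumes \<gamma>: "\<gamma> \<in> carrier SU21" and \<Phi>: "\<And>n. \<Phi> n \<in> Ptilde" "\<And>n. act \<gamma> (\<Phi> n) = \<Phi> (n + 1)"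
  shows "act (\<gamma> [^]\<^bsub>SU21\<^esub> n) (\<Phi> m) = \<Phi> (m + n)"
proof -
  have step: "act (\<gamma> [^]\<^bsub>SU21\<^esub> (i + 1)) (\<Phi> m) = act (\<gamma> [^]\<^bsub>SU21\<^esub> i) (\<Phi> (m + 1))" for i m :: int
    using act_mult[OF SU21.int_pow_closed[OF \<gamma>] \<gamma> \<Phi>(1)] SU21.int_pow_mult[OF \<gamma>, of i 1] \<gamma> \<Phi>(2)
    by simp
  \<comment> \<open>The claim is generalized over \<open>m\<close> because \<open>step\<close>
    trades one power of the generator for a shift of the starting index.\<close>
  have "\<forall>m. act (\<gamma> [^]\<^bsub>SU21\<^esub> n) (\<Phi> m) = \<Phi> (m + n)"
  proof (induction n rule: int_induct[where k = 0])
    case base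
    then show ?case
      by (simp add: act_one \<Phi>(1))
  next
    case (step1 i)
    show ?case
    proof
      fix m
      show "act (\<gamma> [^]\<^bsub>SU21\<^esub> (i + 1)) (\<Phi> m) = \<Phi> (m + (i + 1))"
        using step[of i m] step1(2) by (simp add: algebra_simps)
    qed
  next
    case (step2 i)
    show ?case
    proof
      fix m
      show "act (\<gamma> [^]\<^bsub>SU21\<^esub> (i - 1)) (\<Phi> m) = \<Phi> (m + (i - 1))"
        \<comment> \<open>Going backwards, the power \<open>i\<close> applied at index
          \<open>m - 1\<close> equals the power \<open>i - 1\<close> applied at index
          \<open>m\<close>.\<close>
        using step[of "i - 1" "m - 1"] step2(2) by (simp add: algebra_simps)
    qed
  qed
  then show ?thesis
    by blast
qed

text \<open>For positive \<open>lam\<close> the entries are cosh and sinh of \<open>ln lam\<close>: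
  a translation along the axis of the ball in the second coordinate. This is the lift of
  \<open>\<gamma>0\<close> in the frame \<open>A\<close>.\<close>

definition boost :: "real \<Rightarrow> complex^3^3" where
  "boost lam = vector [vector [1, 0, 0],
     vector [0, of_real ((lam + inverse lam) / 2), of_real ((lam - inverse lam) / 2)],
     vector [0, of_real ((lam - inverse lam) / 2), of_real ((lam + inverse lam) / 2)]]"

lemma boost_mult:
  "boost lam *v Z = vector [Z$1,
     of_real ((lam + inverse lam) / 2) * Z$2 + of_real ((lam - inverse lam) / 2) * Z$3,
     of_real ((lam - inverse lam) / 2) * Z$2 + of_real ((lam + inverse lam) / 2) * Z$3]"
  by (simp add: vec_eq_iff forall_3 matrix_vector_mult_3 boost_def)

lemma det_boost: "lam \<noteq> 0 \<Longrightarrow> det (boost lam) = 1"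
  by (simp add: boost_def det_3 field_simps)

lemma frame_matrix_mult:
  "frame_matrix v X Y *v Z = Z$1 *s v + Z$2 *s ((1 / herm X Y) *s X + (1/2) *s Y)
     + Z$3 *s ((1 / herm X Y) *s X - (1/2) *s Y)"
  by (simp add: vec_eq_iff matrix_vector_mult_3 frame_matrix_def transpose_def algebra_simps
      add_divide_distrib diff_divide_distrib)

text \<open>The frame sends the first basis vector to \<open>v\<close>, and the sum and the
  difference of the last two to multiples of \<open>X\<close> and \<open>Y\<close>. These three
  vectors are eigenvectors of \<open>boost lam\<close> for 1, \<open>lam\<close> and
  \<open>inverse lam\<close>.\<close>

lemma frame_matrix_boost:
  assumes "M *v X = of_real lam *s X" "M *v Y = of_real (inverse lam) *s Y" "M *v v = v"
  shows "M ** frame_matrix v X Y = frame_matrix v X Y ** boost lam"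
proof -
  have "M *v (frame_matrix v X Y *v Z) = frame_matrix v X Y *v (boost lam *v Z)" for Z
    by (simp only: frame_matrix_mult boost_mult matrix_vector_right_distrib
        matrix_vector_mult_diff_distrib vector_scalar_commute assms)
      (simp add: vec_eq_iff algebra_simps add_divide_distrib diff_divide_distrib)
  then show ?thesis
    by (simp add: matrix_eq matrix_vector_mul_assoc[symmetric])
qed

text \<open>A negative vector has second coordinate smaller in modulus than the third. The
  nonvanishing sum and difference are the light-cone coordinates in which the boost is
  diagonal.\<close>

lemma herm_neg_third_pm:
  assumes "Re (herm Z Z) < 0"
  shows "Z$3 + Z$2 \<noteq> 0" "Z$3 - Z$2 \<noteq> 0"
proof -
  have "cmod (Z$2) \<noteq> cmod (Z$3)"
  proof
    assume "cmod (Z$2) = cmod (Z$3)"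
    then show False
      using assms zero_le_power2[of "cmod (Z$1)"] by (simp add: Re_herm_self)
  qed
  then show "Z$3 + Z$2 \<noteq> 0" "Z$3 - Z$2 \<noteq> 0"
    by (auto simp: add_eq_0_iff)
qed

text \<open>The hypothesis on \<open>\<gamma>0\<close> concerns its action and not its matrix: the
  eigenvector equations hold for a lift, which may differ from \<open>\<gamma>0\<close> by a
  scalar.\<close>

locale boost_surface =
  fixes \<gamma>0 A :: "complex^3^3" and lam :: real and k l :: nat
  assumes \<gamma>0: "\<gamma>0 \<in> carrier SU21" and A: "A \<in> carrier SU21"
    and act_\<gamma>0: "\<And>Z \<eta>. Re (herm Z Z) < 0 \<Longrightarrow>
      act \<gamma>0 (proj_pt (A *v Z) \<eta>) = proj_pt (A *v (boost lam *v Z)) \<eta>"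
    and lam: "\<bar>lam\<bar> > 1" and k: "k > 0" and l: "l > 0"
begin

definition T :: real where "T = ln \<bar>lam\<bar>"

definition R :: real where "R = sqrt (real l / (3 * real k + real l))"

definition slope :: real where "slope = real l / real k"

text \<open>Normalized so that \<open>herm\<close> of the vector with itself is the constant
  \<open>R\<^sup>2 - 1\<close> whenever \<open>u\<close> has modulus 1. The fibre coordinate
  \<open>\<eta>\<close> then has constant modulus on the surface, which is the factor in
  \<open>fib\<close>.\<close>

definition cyl :: "complex \<Rightarrow> real \<Rightarrow> real \<Rightarrow> complex^3" where
  "cyl u t \<Theta> = vector [u * of_real R * cis \<Theta>, of_real (sinh t), of_real (cosh t)]"

definition fib :: "complex \<Rightarrow> real \<Rightarrow> complex" where
  "fib u \<Theta> = u * (of_real ((1 - R\<^sup>2) powr (3/2)) * cis (- slope * \<Theta>))"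

text \<open>For \<open>u = 1\<close> this parametrizes \<open>Lambda_tilde\<close>, with \<open>r = exp (2 t)\<close>. For negative \<open>lam\<close>,
  \<open>\<gamma>0\<close> interchanges the two signs of \<open>u\<close>.\<close>

definition surf :: "complex \<Rightarrow> real \<Rightarrow> real \<Rightarrow> (complex^2) \<times> complex" where
  "surf u t \<Theta> = proj_pt (A *v cyl u t \<Theta>) (fib u \<Theta>)"

text \<open>The expression is homogeneous of degree 0 in \<open>W\<close>, hence a function on the
  ball. The boost multiplies numerator and denominator by the moduli of \<open>lam\<close> and
  \<open>inverse lam\<close>, and on the surface they are proportional to \<open>exp t\<close> and
  \<open>exp (- t)\<close>.\<close>

definition height :: "(complex^2) \<times> complex \<Rightarrow> real" where
  "height p = (let W = matrix_inv A *v homog (fst p) in ln (cmod (W$3 + W$2) / cmod (W$3 - W$2)) / 2)"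

lemma T_pos: "T > 0"
  using lam by (simp add: T_def)

lemma slope: "slope > 0" "real k * slope = real l"
  using k l by (simp_all add: slope_def)

lemma R_sq: "R\<^sup>2 = real l / (3 * real k + real l)"
  by (simp add: R_def)

lemma R_bounds: "0 < R" "R\<^sup>2 < 1"
  using k l by (simp_all add: R_def)

lemma herm_A: "herm (A *v Z) (A *v W) = herm Z W"
  using A by (simp add: carrier_SU21 herm_mult_U21)

lemma herm_cyl: "cmod u = 1 \<Longrightarrow> Re (herm (cyl u t \<Theta>) (cyl u t \<Theta>)) = R\<^sup>2 - 1"
  by (simp add: Re_herm_self cyl_def norm_mult cosh_square_eq)

lemma herm_cyl_neg: "cmod u = 1 \<Longrightarrow> Re (herm (cyl u t \<Theta>) (cyl u t \<Theta>)) < 0"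
  using R_bounds by (simp add: herm_cyl)

lemma surf_in_Ptilde: "cmod u = 1 \<Longrightarrow> surf u t \<Theta> \<in> Ptilde"
  unfolding surf_def
  by (intro proj_pt_in_Ptilde) (use R_bounds in \<open>simp_all add: herm_A herm_cyl fib_def norm_mult\<close>)

lemma Ptilde_obtain_frame:
  assumes "p \<in> Ptilde"
  obtains Z \<eta> where "p = proj_pt (A *v Z) \<eta>" "Re (herm Z Z) < 0"
proof
  define Z where "Z = matrix_inv A *v homog (fst p)"
  have AZ: "A *v Z = homog (fst p)"
    using matrix_inv_SU21(3)[OF A] by (simp add: Z_def matrix_vector_mul_assoc)
  show "p = proj_pt (A *v Z) (snd p)"
    by (simp add: AZ)
  show "Re (herm Z Z) < 0"
    unfolding herm_A[of Z Z, symmetric] AZ by (rule herm_homog_Ptilde[OF assms])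
qed

lemma height_proj_pt:
  assumes "Re (herm Z Z) < 0"
  shows "height (proj_pt (A *v Z) \<eta>) = ln (cmod (Z$3 + Z$2) / cmod (Z$3 - Z$2)) / 2"
proof -
  define c where "c = inverse ((A *v Z)$3)"
  have nz: "(A *v Z)$3 \<noteq> 0"
    using assms by (intro herm_neg_third) (simp add: herm_A)
  have "homog (fst (proj_pt (A *v Z) \<eta>)) = c *s (A *v Z)"
    using nz by (simp add: c_def proj_pt_def vec_eq_iff forall_3 field_simps)
  then have "matrix_inv A *v homog (fst (proj_pt (A *v Z) \<eta>)) = c *s Z"
    using matrix_inv_SU21(2)[OF A] by (simp add: vector_scalar_commute matrix_vector_mul_assoc)
  moreover have "c \<noteq> 0"
    using nz by (simp add: c_def)
  ultimately show ?thesis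
    unfolding height_def
    by (simp add: Let_def norm_mult flip: distrib_left right_diff_distrib)
qed

lemma height_act_\<gamma>0:
  assumes "p \<in> Ptilde"
  shows "height (act \<gamma>0 p) = height p + T"
proof -
  obtain Z \<eta> where p: "p = proj_pt (A *v Z) \<eta>" and Z: "Re (herm Z Z) < 0"
    using Ptilde_obtain_frame[OF assms] .
  have lam0: "lam \<noteq> 0"
    using lam by auto
  define B where "B = boost lam *v Z"
  have half: "of_real ((a - b) / 2) * x + of_real ((a + b) / 2) * y
        + (of_real ((a + b) / 2) * x + of_real ((a - b) / 2) * y) = of_real a * (y + x)"
      "of_real ((a - b) / 2) * x + of_real ((a + b) / 2) * y
        - (of_real ((a + b) / 2) * x + of_real ((a - b) / 2) * y) = of_real b * (y - x)"
    for a b :: real and x y :: complex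
    by (simp_all add: field_simps)
  have B: "B$1 = Z$1" "B$3 + B$2 = of_real lam * (Z$3 + Z$2)" "B$3 - B$2 = of_real (inverse lam) * (Z$3 - Z$2)"
    unfolding B_def boost_mult vector_3 by (rule refl half)+
  \<comment> \<open>In light-cone coordinates the form pairs the sum only with the difference, so
    the factors \<open>lam\<close> and \<open>inverse lam\<close> cancel and the boost preserves
    it.\<close>
  have "herm B B = B$1 * cnj (B$1) - ((B$3 + B$2) * cnj (B$3 - B$2) + (B$3 - B$2) * cnj (B$3 + B$2)) / 2"
    by (simp add: herm_def field_simps)
  also have "\<dots> = herm Z Z"
    unfolding B using lam0 by (simp add: herm_def field_simps)
  finally have "Re (herm B B) < 0"
    using Z by simp
  moreover have "cmod (Z$3 + Z$2) > 0" "cmod (Z$3 - Z$2) > 0"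
    using herm_neg_third_pm[OF Z] by simp_all
  moreover have "ln (\<bar>lam\<bar> * x / (inverse \<bar>lam\<bar> * y)) = ln (x / y) + 2 * T" if "x > 0" "y > 0" for x y :: real
    using that lam0 by (simp add: T_def ln_div ln_mult ln_inverse)
  ultimately show ?thesis
    unfolding p act_\<gamma>0[OF Z] by (simp add: B_def[symmetric] height_proj_pt Z B norm_mult norm_inverse)
qed

lemma height_surf:
  assumes "cmod u = 1"
  shows "height (surf u t \<Theta>) = t"
proof -
  have "cosh t + sinh t = exp t" "cosh t - sinh t = exp (- t)"
    by (simp_all add: cosh_def sinh_def field_simps)
  then have "cmod (cyl u t \<Theta> $ 3 + cyl u t \<Theta> $ 2) = exp t" "cmod (cyl u t \<Theta> $ 3 - cyl u t \<Theta> $ 2) = exp (- t)"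
    by (simp_all add: cyl_def flip: of_real_add of_real_diff)
  then show ?thesis
    unfolding surf_def height_proj_pt[OF herm_cyl_neg[OF assms]]
    by (simp flip: exp_diff)
qed

lemma continuous_on_height: "continuous_on Ptilde height"
proof -
  have "(matrix_inv A *v homog (fst p))$3 + (matrix_inv A *v homog (fst p))$2 \<noteq> 0"
    "(matrix_inv A *v homog (fst p))$3 - (matrix_inv A *v homog (fst p))$2 \<noteq> 0" if "p \<in> Ptilde" for p
    using herm_homog_Ptilde[OF that] matrix_inv_SU21(1)[OF A]
    by (intro herm_neg_third_pm; simp add: carrier_SU21 herm_mult_U21)+
  moreover have "continuous_on Ptilde (\<lambda>p. (matrix_inv A *v homog (fst p))$i)" for i
    by (simp add: matrix_vector_mult_3) (intro continuous_intros)
  ultimately show ?thesis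
    unfolding height_def Let_def
    by (intro continuous_on_divide continuous_on_ln continuous_on_norm continuous_on_add
        continuous_on_diff continuous_on_const) auto
qed

text \<open>The addition theorems for sinh and cosh, with the sign of \<open>lam\<close> pulled out
  of the last two coordinates. The boost fixes the first coordinate, so there the sign is
  compensated by changing \<open>u\<close>.\<close>

lemma boost_cyl:
  "boost lam *v cyl u t \<Theta> = of_real (sgn lam) *s cyl (of_real (sgn lam) * u) (t + T) \<Theta>"
proof -
  define s where "s = complex_of_real (sgn lam)"
  have expT: "exp T = \<bar>lam\<bar>"
    using lam by (simp add: T_def)
  have "cosh T = (\<bar>lam\<bar> + inverse \<bar>lam\<bar>) / 2" "sinh T = (\<bar>lam\<bar> - inverse \<bar>lam\<bar>) / 2"
    by (simp_all add: cosh_def sinh_def exp_minus expT)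
  then have "(lam + inverse lam) / 2 = sgn lam * cosh T" "(lam - inverse lam) / 2 = sgn lam * sinh T"
    using lam by (simp_all add: sgn_if abs_if)
  then have c: "complex_of_real ((lam + inverse lam) / 2) = s * of_real (cosh T)"
    "complex_of_real ((lam - inverse lam) / 2) = s * of_real (sinh T)"
    by (simp_all only: s_def of_real_mult)
  have ss: "s * (s * z) = z" for z
    using lam by (auto simp: s_def sgn_if)
  show ?thesis
    unfolding boost_mult c s_def[symmetric]
    by (simp add: cyl_def vec_eq_iff forall_3 cosh_add sinh_add algebra_simps ss)
qed

lemma act_\<gamma>0_surf:
  assumes "cmod u = 1"
  shows "act \<gamma>0 (surf u t \<Theta>) = surf (of_real (sgn lam) * u) (t + T) \<Theta>"
proof -
  have s: "complex_of_real (sgn lam) = 1 \<or> complex_of_real (sgn lam) = - 1"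
    using lam by (auto simp: sgn_if)
  \<comment> \<open>The scalar extracted from \<open>cyl\<close> enters the fibre with exponent 3,
    and the changed \<open>u\<close> supplies a fourth factor; the fourth power of a sign is
    1.\<close>
  then have fib: "fib u \<Theta> = of_real (sgn lam) ^ 3 * fib (of_real (sgn lam) * u) \<Theta>"
    by (auto simp: fib_def)
  show ?thesis
    unfolding surf_def act_\<gamma>0[OF herm_cyl_neg[OF assms]] boost_cyl vector_scalar_commute fib
    by (rule proj_pt_scale) (use s in auto)
qed

lemma act_pow_surf:
  fixes n :: int
  assumes "cmod u = 1"
  shows "act (\<gamma>0 [^]\<^bsub>SU21\<^esub> n) (surf u t \<Theta>) = surf (of_real (sgn lam) powi n * u) (t + of_int n * T) \<Theta>"
proof -
  have nz: "sgn lam \<noteq> 0" and s: "\<bar>sgn lam\<bar> = 1"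
    using lam by (auto simp: sgn_if)
  define \<Phi> where "\<Phi> n = surf (of_real (sgn lam) powi n * u) (t + of_int n * T) \<Theta>" for n :: int
  have u: "cmod (of_real (sgn lam) powi n * u) = 1" for n :: int
    using assms s by (simp add: norm_mult norm_power_int)
  have "act (\<gamma>0 [^]\<^bsub>SU21\<^esub> n) (\<Phi> 0) = \<Phi> (0 + n)"
    using \<gamma>0
  proof (rule act_int_pow)
    show "\<Phi> n \<in> Ptilde" for n
      unfolding \<Phi>_def by (rule surf_in_Ptilde[OF u])
    show "act \<gamma>0 (\<Phi> n) = \<Phi> (n + 1)" for n
      unfolding \<Phi>_def act_\<gamma>0_surf[OF u] using nz by (simp add: power_int_add algebra_simps)
  qed
  then show ?thesis
    by (simp add: \<Phi>_def)
qed

lemma height_act_pow: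
  fixes n :: int
  assumes p: "p \<in> Ptilde"
  shows "height (act (\<gamma>0 [^]\<^bsub>SU21\<^esub> n) p) = height p + of_int n * T"
proof -
  have "act (\<gamma>0 [^]\<^bsub>SU21\<^esub> (i + 1)) p = act \<gamma>0 (act (\<gamma>0 [^]\<^bsub>SU21\<^esub> i) p)" for i :: int
    using act_mult[OF \<gamma>0 SU21.int_pow_closed[OF \<gamma>0] p, of i] SU21.int_pow_mult[OF \<gamma>0, of 1 i] \<gamma>0
    by (simp add: add.commute)
  then have step: "height (act (\<gamma>0 [^]\<^bsub>SU21\<^esub> (i + 1)) p) = height (act (\<gamma>0 [^]\<^bsub>SU21\<^esub> i) p) + T" for i :: int
    using height_act_\<gamma>0 act_in_Ptilde[OF SU21.int_pow_closed[OF \<gamma>0] p] by simp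
  show ?thesis
  proof (induction n rule: int_induct[where k = 0])
    case base
    then show ?case
      by (simp add: act_one p)
  next
    case (step1 i)
    then show ?case
      using step[of i] by (simp add: algebra_simps)
  next
    case (step2 i)
    then show ?case
      using step[of "i - 1"] by (simp add: algebra_simps)
  qed
qed

end

lemma cis_Arg_of_real_mult: "r > 0 \<Longrightarrow> cmod w = 1 \<Longrightarrow> cis (Arg (of_real r * w)) = w"
  by (subst cis_Arg) (auto simp: sgn_eq norm_mult)

lemma Arg_of_real_cis: "r > 0 \<Longrightarrow> - pi < x \<Longrightarrow> x \<le> pi \<Longrightarrow> Arg (of_real r * cis x) = x"
  using Arg_rcis[of x r] by (simp add: rcis_def)

section \<open>Comparison with the coordinates of the ball, and the two sheets\<close>

context boost_surface
begin

text \<open>At angle \<open>pi / 2\<close> and radius \<open>exp (2 * t)\<close> the Cayley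
  transform gives tanh of \<open>t\<close>, and \<open>1 / cosh t\<close> is the square root in the
  first coordinate.\<close>

lemma proj_pt_cyl_ball_coords:
  fixes t \<Theta> :: real
  defines "w \<equiv> ball_coords (exp (2 * t)) (pi / 2) R \<Theta>"
  shows "proj_pt (cyl 1 t \<Theta>) (fib 1 \<Theta>)
    = (w, of_real (rho w powr (3/2)) * cis (- slope * \<Theta>))"
proof -
  define w2 where "w2 = (complex_of_real (exp (2 * t)) * cis (pi / 2) - \<i>) / (of_real (exp (2 * t)) * cis (pi / 2) + \<i>)"
  define p where "p = proj_pt (cyl 1 t \<Theta>) (fib 1 \<Theta>)"
  have ch: "cosh t > 0"
    by simp
  have "(exp t * exp t - 1) * (exp t + inverse (exp t)) = (exp t * exp t + 1) * (exp t - inverse (exp t))"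
    by (simp add: field_simps)
  then have e: "(exp (2 * t) - 1) * cosh t = (exp (2 * t) + 1) * sinh t"
    by (simp add: cosh_def sinh_def exp_minus mult_exp_exp)
  have "w2 = (\<i> * of_real (exp (2 * t) - 1)) / (\<i> * of_real (exp (2 * t) + 1))"
    by (simp add: w2_def algebra_simps)
  also have "\<dots> = of_real ((exp (2 * t) - 1) / (exp (2 * t) + 1))"
    by (simp only: mult_divide_mult_cancel_left_if of_real_divide) simp
  also have "(exp (2 * t) - 1) / (exp (2 * t) + 1) = sinh t / cosh t"
    using e ch by (subst frac_eq_eq) (simp_all add: add_pos_pos less_imp_neq[symmetric] mult.commute)
  finally have w2: "w2 = of_real (sinh t / cosh t)" .
  have "(cosh t)\<^sup>2 - (sinh t)\<^sup>2 = 1"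
    by (simp add: cosh_square_eq)
  moreover have "1 - (sinh t / cosh t)\<^sup>2 = ((cosh t)\<^sup>2 - (sinh t)\<^sup>2) / (cosh t)\<^sup>2"
    using ch by (simp add: power_divide diff_divide_distrib)
  ultimately have "1 - (sinh t / cosh t)\<^sup>2 = (1 / cosh t)\<^sup>2"
    by (simp add: power_divide)
  then have sq: "sqrt (1 - (cmod w2)\<^sup>2) = 1 / cosh t"
    by (simp add: w2 norm_divide real_sqrt_divide power_divide)
  then have w: "w = fst p"
    unfolding w_def ball_coords_def Let_def w2_def[symmetric]
    by (simp add: sq p_def proj_pt_def cyl_def vec_eq_iff forall_2) (simp add: w2)
  \<comment> \<open>Membership in \<open>Ptilde\<close> yields the modulus of the fibre coordinate
    in terms of \<open>rho w\<close>, so only its phase is left to compare.\<close>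
  have "p \<in> Ptilde"
    unfolding p_def
    by (rule proj_pt_in_Ptilde) (use R_bounds in \<open>simp_all add: herm_cyl fib_def norm_mult\<close>)
  then have "rho w powr (3/2) = cmod (snd p)"
    unfolding w by (auto simp: Ptilde_def)
  also have "\<dots> = (1 - R\<^sup>2) powr (3/2) / cosh t ^ 3"
    by (simp add: p_def proj_pt_def cyl_def fib_def norm_mult norm_divide norm_power)
  finally have "snd p = of_real (rho w powr (3/2)) * cis (- slope * \<Theta>)"
    by (simp add: p_def proj_pt_def cyl_def fib_def)
  then show ?thesis
    unfolding p_def[symmetric] by (simp add: w prod_eq_iff)
qed

lemma T_tilde_eq: "T_tilde k l = range (\<lambda>(t, \<Theta>). proj_pt (cyl 1 t \<Theta>) (fib 1 \<Theta>))"
proof (intro equalityI subsetI)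
  fix p assume "p \<in> T_tilde k l"
  then obtain r \<Theta> where "r > 0"
    and p: "p = (ball_coords r (pi/2) R \<Theta>, of_real (rho (ball_coords r (pi/2) R \<Theta>) powr (3/2)) * cis (- slope * \<Theta>))"
    unfolding T_tilde_def R_def slope_def by blast
  then have r: "exp (2 * (ln r / 2)) = r"
    by simp
  have "p = proj_pt (cyl 1 (ln r / 2) \<Theta>) (fib 1 \<Theta>)"
    unfolding proj_pt_cyl_ball_coords r p ..
  then show "p \<in> range (\<lambda>(t, \<Theta>). proj_pt (cyl 1 t \<Theta>) (fib 1 \<Theta>))"
    by auto
next
  fix p assume "p \<in> range (\<lambda>(t, \<Theta>). proj_pt (cyl 1 t \<Theta>) (fib 1 \<Theta>))"
  then obtain t \<Theta> where "p = proj_pt (cyl 1 t \<Theta>) (fib 1 \<Theta>)"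
    by auto
  moreover have "exp (2 * t) > 0"
    by simp
  ultimately show "p \<in> T_tilde k l"
    unfolding proj_pt_cyl_ball_coords T_tilde_def R_def slope_def by blast
qed

lemma T_tilde_subset: "T_tilde k l \<subseteq> Ptilde"
  unfolding T_tilde_eq
  by (auto intro!: proj_pt_in_Ptilde simp: herm_cyl fib_def norm_mult)
    (use R_bounds in auto)

lemma Lambda_tilde_eq: "Lambda_tilde A k l = range (\<lambda>(t, \<Theta>). surf 1 t \<Theta>)"
  unfolding Lambda_tilde_def T_tilde_eq surf_def image_image
  by (intro image_cong refl) (auto simp: act_proj_pt[OF A herm_cyl_neg])

text \<open>The union is invariant under all powers of \<open>\<gamma>0\<close> for either sign of
  \<open>lam\<close>. The two sheets coincide or are disjoint, depending on \<open>k\<close> and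
  \<open>l\<close>.\<close>

definition sheets :: "((complex^2) \<times> complex) set" where
  "sheets = {surf u t \<Theta> | u t \<Theta>. u = 1 \<or> u = - 1}"

lemma sheets_subset: "sheets \<subseteq> Ptilde"
  unfolding sheets_def using surf_in_Ptilde by force

lemma act_pow_sheets:
  fixes n :: int
  assumes "p \<in> sheets"
  shows "act (\<gamma>0 [^]\<^bsub>SU21\<^esub> n) p \<in> sheets"
proof -
  obtain u t \<Theta> where p: "p = surf u t \<Theta>" and u: "u = 1 \<or> u = - 1"
    using assms by (auto simp: sheets_def)
  have "(complex_of_real (sgn lam) powi n)\<^sup>2 = ((of_real (sgn lam))\<^sup>2) powi n"
    by (simp add: power_int_mult_distrib power2_eq_square)
  also have "(complex_of_real (sgn lam))\<^sup>2 = 1"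
    using lam by (auto simp: sgn_if)
  finally have "complex_of_real (sgn lam) powi n = 1 \<or> complex_of_real (sgn lam) powi n = - 1"
    by (simp add: power2_eq_1_iff)
  with u have "of_real (sgn lam) powi n * u = 1 \<or> of_real (sgn lam) powi n * u = - 1"
    by auto
  moreover have "cmod u = 1"
    using u by auto
  ultimately show ?thesis
    unfolding p sheets_def by (auto simp: act_pow_surf)
qed

text \<open>The rotation by \<open>\<Theta>0\<close>, and by \<open>slope * \<Theta>0\<close> in the
  fibre, makes both coordinates positive real at angle \<open>\<Theta>0\<close> of the sheet
  \<open>u = 1\<close>, away from the cut of \<open>Arg\<close>.\<close>

definition base_coord :: "real \<Rightarrow> (complex^2) \<times> complex \<Rightarrow> complex" where
  "base_coord \<Theta>0 p = fst (act (matrix_inv A) p) $ 1 * cis (- \<Theta>0)"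

definition fib_coord :: "real \<Rightarrow> (complex^2) \<times> complex \<Rightarrow> complex" where
  "fib_coord \<Theta>0 p = snd (act (matrix_inv A) p) * cis (slope * \<Theta>0)"

lemma act_inv_surf: "cmod u = 1 \<Longrightarrow> act (matrix_inv A) (surf u t \<Theta>) = proj_pt (cyl u t \<Theta>) (fib u \<Theta>)"
  unfolding surf_def using matrix_inv_SU21[OF A] herm_cyl_neg[of u t \<Theta>]
  by (subst act_proj_pt) (simp_all add: herm_A matrix_vector_mul_assoc)

lemma base_coord_surf:
  "cmod u = 1 \<Longrightarrow> base_coord \<Theta>0 (surf u t \<Theta>) = of_real (R / cosh t) * (u * cis (\<Theta> - \<Theta>0))"
  unfolding base_coord_def act_inv_surf diff_conv_add_uminus cis_mult[symmetric]
  by (simp add: proj_pt_def cyl_def)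

lemma fib_coord_surf:
  "cmod u = 1 \<Longrightarrow> fib_coord \<Theta>0 (surf u t \<Theta>) =
    of_real ((1 - R\<^sup>2) powr (3/2) / cosh t ^ 3) * (u * cis (- slope * (\<Theta> - \<Theta>0)))"
proof -
  assume u: "cmod u = 1"
  have "cis (- slope * (\<Theta> - \<Theta>0)) = cis (- slope * \<Theta>) * cis (slope * \<Theta>0)"
    by (simp add: cis_mult algebra_simps)
  then show ?thesis
    unfolding fib_coord_def act_inv_surf[OF u] by (simp add: proj_pt_def cyl_def fib_def)
qed

lemma continuous_on_coords:
  "continuous_on Ptilde (base_coord \<Theta>0)" "continuous_on Ptilde (fib_coord \<Theta>0)"
  unfolding base_coord_def fib_coord_def
  by (intro continuous_intros continuous_on_act matrix_inv_SU21(1) A)+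

text \<open>Chosen with \<open>(real k + real l) * patch_angle = pi / 2\<close>, so that angles
  below this bound give a combination of size less than \<open>pi\<close>. The smaller
  \<open>patch_width\<close> bounds \<open>\<Theta>\<close> such that the fibre angle, which is
  \<open>slope\<close> times larger, also stays below \<open>patch_angle\<close>.\<close>

definition patch_angle :: real where
  "patch_angle = pi / (2 * (real k + real l))"

definition patch_width :: real where
  "patch_width = patch_angle / (real k + real l)"

lemma patch_bounds:
  "0 < patch_angle" "0 < patch_width" "patch_width \<le> patch_angle" "patch_angle < pi / 2"
  "slope * patch_width \<le> patch_angle" "(real k + real l) * patch_angle = pi / 2"
proof -
  define n where "n = real k + real l"
  have "slope \<le> real l"
    using k l by (simp add: slope_def divide_le_eq)
  then have n: "n > 1" "slope \<le> n"
    using k l by (simp_all add: n_def)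
  have pa: "patch_angle = pi / (2 * n)" and pw: "patch_width = patch_angle / n"
    by (simp_all add: patch_angle_def patch_width_def n_def)
  show pos: "0 < patch_angle"
    using n by (simp add: pa)
  then show "0 < patch_width"
    using n by (simp add: pw)
  show "patch_width \<le> patch_angle"
    using pos n by (simp add: pw divide_le_eq)
  show "(real k + real l) * patch_angle = pi / 2"
    unfolding n_def[symmetric] pa using n by simp
  show "patch_angle < pi / 2"
    unfolding pa using n by (intro divide_strict_left_mono) auto
  show "slope * patch_width \<le> patch_angle"
    using pos n by (simp add: pw divide_le_eq mult.commute)
qed

text \<open>Along both sheets \<open>k \<psi> + l \<Theta>\<close> is a multiple of \<open>\<pi>\<close>. Close to a point of the sheet \<open>u = 1\<close>
  it is small, hence \<open>0\<close>, so no other branch of the sheets comes near.\<close>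

lemma openin_sheets_surf:
  fixes W :: "(real^2) set"
  assumes W: "open W" "\<And>x. x \<in> W \<Longrightarrow> \<bar>x$2 - \<Theta>0\<bar> < patch_width"
  shows "openin (top_of_set sheets) ((\<lambda>x. surf 1 (x$1) (x$2)) ` W)"
proof -
  \<comment> \<open>On the right half-planes \<open>Arg\<close> is continuous.\<close>
  define D where "D = {p \<in> Ptilde. Re (base_coord \<Theta>0 p) > 0 \<and> Re (fib_coord \<Theta>0 p) > 0}"
  \<comment> \<open>The last component inverts the parametrization; the fibre argument is recorded
    in addition to exclude other branches over the same base point.\<close>
  define g where "g p = (Arg (fib_coord \<Theta>0 p), vector [height p, \<Theta>0 + Arg (base_coord \<Theta>0 p)] :: real^2)" for p
  define O' where "O' = D \<inter> g -` ({- patch_angle <..< patch_angle} \<times> W)"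
  have "D = (Ptilde \<inter> (\<lambda>p. Re (base_coord \<Theta>0 p)) -` {0<..}) \<inter> (Ptilde \<inter> (\<lambda>p. Re (fib_coord \<Theta>0 p)) -` {0<..})"
    by (auto simp: D_def)
  also have "openin (top_of_set Ptilde) \<dots>"
    by (intro openin_Int continuous_openin_preimage_gen continuous_on_Re continuous_on_coords open_greaterThan)
  finally have D: "openin (top_of_set Ptilde) D" .
  have DP: "D \<subseteq> Ptilde"
    by (auto simp: D_def)
  have nonpos: "z \<notin> \<real>\<^sub>\<le>\<^sub>0" if "Re z > 0" for z
    using that by (auto simp: complex_nonpos_Reals_iff)
  have "continuous_on D g"
    unfolding g_def
    by (intro continuous_on_Pair continuous_on_vector_2 continuous_on_add continuous_on_const
        continuous_on_Arg' continuous_on_coords[THEN continuous_on_subset[OF _ DP]]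
        continuous_on_height[THEN continuous_on_subset[OF _ DP]] nonpos) (auto simp: D_def)
  then have "openin (top_of_set D) O'"
    unfolding O'_def by (intro continuous_openin_preimage_gen open_Times W(1)) auto
  then have "openin (top_of_set Ptilde) O'"
    using D by (rule openin_trans)
  then obtain Q where Q: "open Q" "O' = Ptilde \<inter> Q"
    by (auto simp: openin_open)
  have "(\<lambda>x. surf 1 (x$1) (x$2)) ` W = sheets \<inter> O'"
  proof (intro equalityI subsetI)
    fix p assume "p \<in> (\<lambda>x. surf 1 (x$1) (x$2)) ` W"
    then obtain x where x: "x \<in> W" and p: "p = surf 1 (x$1) (x$2)"
      by auto
    define d where "d = x$2 - \<Theta>0"
    have d: "\<bar>d\<bar> < patch_width"
      using W(2)[OF x] by (simp add: d_def)
    then have d1: "\<bar>d\<bar> < pi / 2"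
      using patch_bounds by simp
    have "\<bar>- slope * d\<bar> = slope * \<bar>d\<bar>"
      using slope by (simp add: abs_mult)
    also have "\<dots> < slope * patch_width"
      using d slope by (intro mult_strict_left_mono) auto
    finally have d2: "- patch_angle < - slope * d" "- slope * d < patch_angle"
      using patch_bounds(5) by linarith+
    then have d3: "- (pi / 2) < - slope * d" "- slope * d < pi / 2"
      using patch_bounds(4) by linarith+
    define r s where "r = R / cosh (x$1)" and "s = (1 - R\<^sup>2) powr (3/2) / cosh (x$1) ^ 3"
    have rs: "r > 0" "s > 0"
      using R_bounds by (simp_all add: r_def s_def)
    have a: "base_coord \<Theta>0 p = of_real r * cis d"
      and b: "fib_coord \<Theta>0 p = of_real s * cis (- slope * d)"
      unfolding p r_def s_def d_def by (simp_all add: base_coord_surf fib_coord_surf)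
    have Arg: "Arg (base_coord \<Theta>0 p) = d" "Arg (fib_coord \<Theta>0 p) = - slope * d"
      unfolding a b using rs d1 d3 pi_gt_zero by (intro Arg_of_real_cis; linarith)+
    have cospos: "cos d > 0" "cos (- slope * d) > 0"
      using d1 d3 by (intro cos_gt_zero_pi; linarith)+
    have "p \<in> Ptilde"
      unfolding p by (rule surf_in_Ptilde) simp
    then have "p \<in> D"
      using rs cospos by (simp add: D_def a b)
    moreover have "vector [height p, \<Theta>0 + d] = x"
      by (simp add: p height_surf d_def vec_eq_iff forall_2)
    ultimately have "p \<in> O'"
      using d2 x by (simp add: O'_def g_def Arg)
    then show "p \<in> sheets \<inter> O'"
      by (auto simp: sheets_def p)
  next
    fix p assume "p \<in> sheets \<inter> O'"
    then obtain u t \<Theta> where p: "p = surf u t \<Theta>" and u: "u = 1 \<or> u = - 1" and O': "p \<in> O'"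
      by (auto simp: sheets_def)
    have nu: "cmod u = 1"
      using u by auto
    define \<alpha> \<beta> where "\<alpha> = Arg (base_coord \<Theta>0 p)" and "\<beta> = Arg (fib_coord \<Theta>0 p)"
    define x where "x = (vector [t, \<Theta>0 + \<alpha>] :: real^2)"
    have x: "x \<in> W" and \<beta>: "\<bar>\<beta>\<bar> < patch_angle"
      using O' by (auto simp: O'_def g_def x_def \<alpha>_def \<beta>_def p height_surf[OF nu])
    have \<alpha>: "\<bar>\<alpha>\<bar> < patch_angle"
      using W(2)[OF x] patch_bounds by (simp add: x_def)
    have cis\<alpha>: "cis \<alpha> = u * cis (\<Theta> - \<Theta>0)"
      unfolding \<alpha>_def p base_coord_surf[OF nu]
      by (rule cis_Arg_of_real_mult) (use R_bounds nu in \<open>simp_all add: norm_mult\<close>)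
    have cis\<beta>: "cis \<beta> = u * cis (- slope * (\<Theta> - \<Theta>0))"
      unfolding \<beta>_def p fib_coord_surf[OF nu]
      by (rule cis_Arg_of_real_mult) (use R_bounds nu in \<open>simp_all add: norm_mult\<close>)
    have "cis (real k * \<beta> + real l * \<alpha>) = cis \<beta> ^ k * cis \<alpha> ^ l"
      by (simp only: Complex.DeMoivre cis_mult)
    also have "\<dots> = u ^ (k + l) * cis (real k * (- slope * (\<Theta> - \<Theta>0)) + real l * (\<Theta> - \<Theta>0))"
      by (simp only: cis\<alpha> cis\<beta> power_mult_distrib Complex.DeMoivre cis_mult[symmetric] power_add mult_ac)
    also have "real k * (- slope * (\<Theta> - \<Theta>0)) + real l * (\<Theta> - \<Theta>0) = 0"
      using slope by (simp add: algebra_simps)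
    finally have "cis (real k * \<beta> + real l * \<alpha>) = u ^ (k + l)"
      by simp
    moreover have "u ^ (k + l) = 1 \<or> u ^ (k + l) = - 1"
      using u by (cases "even (k + l)") auto
    ultimately have sin: "sin (real k * \<beta> + real l * \<alpha>) = 0"
      by (auto simp flip: cis.sel(2))
    have "\<bar>real k * \<beta> + real l * \<alpha>\<bar> \<le> real k * \<bar>\<beta>\<bar> + real l * \<bar>\<alpha>\<bar>"
      by (rule order_trans[OF abs_triangle_ineq]) (simp add: abs_mult)
    also have "\<dots> \<le> real k * patch_angle + real l * patch_angle"
      using \<alpha> \<beta> by (intro add_mono mult_left_mono) auto
    also have "\<dots> = pi / 2"
      using patch_bounds(6) by (simp add: distrib_right)
    finally have "- pi < real k * \<beta> + real l * \<alpha>" "real k * \<beta> + real l * \<alpha> < pi"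
      using pi_gt_zero by linarith+
    then have "real k * \<beta> + real l * \<alpha> = 0"
      using sin by (rule sin_eq_0_pi)
    then have \<beta>eq: "\<beta> = - slope * \<alpha>"
      using k by (simp add: slope_def eq_divide_eq add_eq_0_iff mult.commute)
    \<comment> \<open>The angles \<open>\<Theta>\<close> and \<open>\<Theta>0 + \<alpha>\<close> may
      differ; the points agree as soon as the unit complex numbers in \<open>cyl\<close> and
      \<open>fib\<close> do, with \<open>u\<close> absorbed.\<close>
    have "cis (\<Theta>0 + \<alpha>) = u * cis \<Theta>"
    proof -
      have "cis (\<Theta>0 + \<alpha>) = cis \<Theta>0 * (u * cis (\<Theta> - \<Theta>0))"
        by (simp only: cis_mult[symmetric] cis\<alpha>)
      also have "\<dots> = u * (cis \<Theta>0 * cis (\<Theta> - \<Theta>0))"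
        by (rule mult.left_commute)
      finally show ?thesis
        by (simp add: cis_mult)
    qed
    moreover have "cis (- slope * (\<Theta>0 + \<alpha>)) = u * cis (- slope * \<Theta>)"
    proof -
      have "- slope * (\<Theta>0 + \<alpha>) = - slope * \<Theta>0 + \<beta>"
        by (simp add: \<beta>eq algebra_simps)
      then have "cis (- slope * (\<Theta>0 + \<alpha>)) = cis (- slope * \<Theta>0) * (u * cis (- slope * (\<Theta> - \<Theta>0)))"
        by (simp only: cis_mult[symmetric] cis\<beta>)
      also have "\<dots> = u * (cis (- slope * \<Theta>0) * cis (- slope * (\<Theta> - \<Theta>0)))"
        by (rule mult.left_commute)
      also have "\<dots> = u * cis (- slope * \<Theta>0 + - slope * (\<Theta> - \<Theta>0))"
        by (simp only: cis_mult)
      also have "- slope * \<Theta>0 + - slope * (\<Theta> - \<Theta>0) = - slope * \<Theta>"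
        by (simp add: algebra_simps)
      finally show ?thesis .
    qed
    ultimately have "cyl 1 t (\<Theta>0 + \<alpha>) = cyl u t \<Theta>" "fib 1 (\<Theta>0 + \<alpha>) = fib u \<Theta>"
      by (simp_all only: cyl_def fib_def mult_1_left mult.left_commute[of u] mult.assoc)
    then have "surf 1 t (\<Theta>0 + \<alpha>) = p"
      by (simp only: p surf_def)
    then have "p = surf 1 (x$1) (x$2)"
      by (simp add: x_def)
    then show "p \<in> (\<lambda>x. surf 1 (x$1) (x$2)) ` W"
      using x by blast
  qed
  also have "\<dots> = sheets \<inter> Q"
    using sheets_subset Q by auto
  finally show ?thesis
    using Q(1) by (simp add: openin_open_Int)
qed

end

subsection \<open>The quotient surface\<close>

lemma continuous_action_subgroup:
  assumes "subgroup H SU21"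
  shows "continuous_action (SUsub H) Ptilde act"
proof (rule continuous_action.intro)
  have H: "g \<in> carrier SU21" if "g \<in> H" for g
    using subgroup.subset[OF assms] that by auto
  show "group (SUsub H)"
    by (rule subgroup.subgroup_is_group[OF assms group_SU21])
  show "act g x \<in> Ptilde" if "g \<in> carrier (SUsub H)" "x \<in> Ptilde" for g x
    using that H by (simp add: act_in_Ptilde)
  show "act \<one>\<^bsub>SUsub H\<^esub> x = x" if "x \<in> Ptilde" for x
    using that by (simp add: act_one)
  show "act (g \<otimes>\<^bsub>SUsub H\<^esub> h) x = act g (act h x)"
    if "g \<in> carrier (SUsub H)" "h \<in> carrier (SUsub H)" "x \<in> Ptilde" for g h x
    using that H by (simp add: act_mult)
  show "continuous_on Ptilde (act g)" if "g \<in> carrier (SUsub H)" for g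
    using that H by (simp add: continuous_on_act)
qed

lemma second_countable_euclidean:
  "second_countable (euclidean :: 'a::second_countable_topology topology)"
proof -
  obtain B :: "'a set set" where B: "countable B" "topological_basis B"
    using ex_countable_basis by blast
  have "\<exists>V\<in>B. x \<in> V \<and> V \<subseteq> U" if "open U" "x \<in> U" for U x
    using topological_basisE[OF B(2) that] by metis
  then show ?thesis
    unfolding second_countable_def using B topological_basis_open[OF B(2)] by auto
qed

lemma natural_proj_orbit:
  assumes \<Gamma>: "subgroup \<Gamma> SU21" and H: "subgroup H SU21" "H \<subseteq> \<Gamma>" and x: "x \<in> Ptilde"
  shows "natural_proj \<Gamma> (orbit (SUsub H) act x) = orbit (SUsub \<Gamma>) act x"
proof (intro equalityI subsetI)
  have sub: "g \<in> carrier SU21" if "g \<in> \<Gamma>" for g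
    using subgroup.subset[OF \<Gamma>] that by auto
  fix y assume "y \<in> natural_proj \<Gamma> (orbit (SUsub H) act x)"
  then obtain g h where "g \<in> \<Gamma>" "h \<in> \<Gamma>" "y = act g (act h x)"
    using H(2) by (auto simp: natural_proj_def orbit_def)
  moreover from this have "g ** h \<in> \<Gamma>"
    using subgroup.m_closed[OF \<Gamma>, of g h] by simp
  moreover from calculation have "y = act (g ** h) x"
    using act_mult[of g h x] sub x by simp
  ultimately have "\<exists>g'. y = act g' x \<and> g' \<in> \<Gamma>"
    by blast
  then show "y \<in> orbit (SUsub \<Gamma>) act x"
    unfolding orbit_def by simp
next
  fix y assume "y \<in> orbit (SUsub \<Gamma>) act x"
  then obtain g where "g \<in> \<Gamma>" "y = act g (act (mat 1) x)"
    using x by (auto simp: orbit_def act_one)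
  moreover have "mat 1 \<in> H"
    using subgroup.one_closed[OF H(1)] by simp
  ultimately show "y \<in> natural_proj \<Gamma> (orbit (SUsub H) act x)"
    by (auto simp: natural_proj_def orbit_def)
qed

text \<open>By the universal property of the quotient, since composing with the finer orbit map
  gives the coarser one.\<close>

lemma continuous_map_natural_proj:
  assumes "subgroup \<Gamma> SU21" "subgroup H SU21" "H \<subseteq> \<Gamma>"
  shows "continuous_map (P_quot H) (P_quot \<Gamma>) (natural_proj \<Gamma>)"
proof (rule continuous_compose_quotient_map[OF quotient_map_orbit_space])
  show "continuous_map (top_of_set Ptilde) (P_quot \<Gamma>) (natural_proj \<Gamma> \<circ> orbit (SUsub H) act)"
    using quotient_imp_continuous_map[OF quotient_map_orbit_space]
    by (rule continuous_map_eq) (simp add: natural_proj_orbit[OF assms])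
qed

lemma Lambda_eq_image: "Lambda \<gamma>0 A k l = orbit (SUsub (cyclic \<gamma>0)) act ` Lambda_tilde A k l"
  by (auto simp: Lambda_def orbits_def)

context boost_surface
begin

lemma subgroup_cyclic: "subgroup (cyclic \<gamma>0) SU21"
  unfolding cyclic_def using \<gamma>0 by (intro SU21.generate_is_subgroup) simp

sublocale cyc: continuous_action "SUsub (cyclic \<gamma>0)" Ptilde act
  by (rule continuous_action_subgroup[OF subgroup_cyclic])

lemma Hausdorff_P_quot_cyclic: "Hausdorff_space (P_quot (cyclic \<gamma>0))"
proof (rule cyc.Hausdorff_orbit_space_translation)
  show "carrier (SUsub (cyclic \<gamma>0)) = range (\<lambda>n::int. \<gamma>0 [^]\<^bsub>SU21\<^esub> n)"
    by (simp add: cyclic_eq[OF \<gamma>0])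
  show "\<exists>U V. open U \<and> open V \<and> x \<in> U \<and> y \<in> V \<and> U \<inter> V = {}" if "x \<noteq> y" for x y :: "(complex^2) \<times> complex"
    using hausdorff[OF that] .
qed (fact T_pos continuous_on_height height_act_pow)+

section \<open>Compactness of the quotient surface\<close>

lemma A_cyl_nz: "(A *v cyl 1 t \<Theta>) $ 3 \<noteq> 0"
  using herm_cyl_neg[of 1] by (intro herm_neg_third) (simp add: herm_A)

lemma continuous_on_surf: "continuous_on UNIV (\<lambda>p. surf 1 (fst p) (snd p))"
proof -
  have "continuous_on UNIV (\<lambda>p. (A *v cyl 1 (fst p) (snd p)) $ i)" for i
    by (simp add: matrix_vector_mult_3 cyl_def) (intro continuous_intros)
  moreover have "continuous_on UNIV (\<lambda>p :: real \<times> real. fib 1 (snd p))"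
    unfolding fib_def by (intro continuous_intros)
  ultimately show ?thesis
    unfolding surf_def proj_pt_def
    by (intro continuous_on_Pair continuous_on_vector_2 continuous_on_divide continuous_on_power)
      (auto simp: A_cyl_nz)
qed

text \<open>After \<open>k\<close> full turns of \<open>\<Theta>\<close> the fibre angle has made
  exactly \<open>l\<close> full turns.\<close>

lemma surf_shift_angle:
  fixes n :: int
  shows "surf 1 t (\<Theta> - 2 * pi * real k * of_int n) = surf 1 t \<Theta>"
proof -
  have per: "cis (x - 2 * pi * of_int m) = cis x" for x and m :: int
    using cis_multiple_2pi[of "of_int m"] by (simp add: cis_divide[symmetric])
  have "- slope * (\<Theta> - 2 * pi * real k * of_int n) = - slope * \<Theta> - 2 * pi * of_int (- (int l * n))"
    using slope by (simp add: algebra_simps)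
  then have "cis (- slope * (\<Theta> - 2 * pi * real k * of_int n)) = cis (- slope * \<Theta>)"
    by (simp only: per)
  moreover have "cis (\<Theta> - 2 * pi * real k * of_int n) = cis \<Theta>"
    using per[of \<Theta> "int k * n"] by (simp add: mult.assoc)
  ultimately show ?thesis
    by (simp only: surf_def cyl_def fib_def)
qed

text \<open>The square of \<open>\<gamma>0\<close> preserves the surface whatever the sign of \<open>lam\<close>.\<close>

lemma orbit_surf_shift:
  fixes n :: int
  shows "orbit (SUsub (cyclic \<gamma>0)) act (surf 1 (t - 2 * T * of_int n) \<Theta>) = orbit (SUsub (cyclic \<gamma>0)) act (surf 1 t \<Theta>)"
proof -
  define m where "m = - (2 * n)"
  have "complex_of_real (sgn lam) powi m = 1"
    using lam by (auto simp: m_def sgn_if power_int_minus power_int_mult)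
  then have "act (\<gamma>0 [^]\<^bsub>SU21\<^esub> m) (surf 1 t \<Theta>) = surf 1 (t - 2 * T * of_int n) \<Theta>"
    by (simp add: act_pow_surf m_def algebra_simps)
  moreover have "\<gamma>0 [^]\<^bsub>SU21\<^esub> m \<in> carrier (SUsub (cyclic \<gamma>0))"
    by (simp add: cyclic_eq[OF \<gamma>0])
  ultimately show ?thesis
    using cyc.orbit_action surf_in_Ptilde[of 1] by (metis norm_one)
qed

text \<open>The rectangle with sides \<open>2 * T\<close> and \<open>2 * pi * real k\<close> maps
  onto the quotient. The factor 2 before \<open>T\<close> is there because only the square of
  \<open>\<gamma>0\<close> is sure to preserve the surface.\<close>

lemma compactin_Lambda: "compactin (P_quot (cyclic \<gamma>0)) (Lambda \<gamma>0 A k l)"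
proof -
  define C where "C = (\<lambda>p. surf 1 (fst p) (snd p)) ` ({0..2 * T} \<times> {0..2 * pi * real k})"
  have "compact C"
    unfolding C_def
    by (intro compact_continuous_image compact_Times continuous_on_subset[OF continuous_on_surf]) auto
  moreover have "C \<subseteq> Ptilde"
    using surf_in_Ptilde[of 1] by (auto simp: C_def)
  ultimately have "compactin (P_quot (cyclic \<gamma>0)) (orbit (SUsub (cyclic \<gamma>0)) act ` C)"
    by (intro image_compactin[OF _ quotient_imp_continuous_map[OF quotient_map_orbit_space]])
      (simp add: compactin_subtopology)
  moreover have "Lambda \<gamma>0 A k l = orbit (SUsub (cyclic \<gamma>0)) act ` C"
    unfolding Lambda_eq_image Lambda_tilde_eq
  proof (intro equalityI subsetI)
    fix q assume "q \<in> orbit (SUsub (cyclic \<gamma>0)) act ` range (\<lambda>(t, \<Theta>). surf 1 t \<Theta>)"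
    then obtain t \<Theta> where q: "q = orbit (SUsub (cyclic \<gamma>0)) act (surf 1 t \<Theta>)"
      by auto
    define n where "n = \<lfloor>t / (2 * T)\<rfloor>"
    define m where "m = \<lfloor>\<Theta> / (2 * pi * real k)\<rfloor>"
    define t' where "t' = t - 2 * T * of_int n"
    define \<Theta>' where "\<Theta>' = \<Theta> - 2 * pi * real k * of_int m"
    have "q = orbit (SUsub (cyclic \<gamma>0)) act (surf 1 t' \<Theta>')"
      unfolding t'_def \<Theta>'_def orbit_surf_shift surf_shift_angle q ..
    moreover have fl: "0 \<le> x - c * of_int \<lfloor>x / c\<rfloor> \<and> x - c * of_int \<lfloor>x / c\<rfloor> \<le> c" if "c > 0" for x c :: real
    proof -
      have "of_int \<lfloor>x / c\<rfloor> * c \<le> x" "x \<le> (of_int \<lfloor>x / c\<rfloor> + 1) * c"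
        by (simp_all only: pos_le_divide_eq[OF that, symmetric] pos_divide_le_eq[OF that, symmetric])
          linarith+
      then show ?thesis
        by (simp add: algebra_simps)
    qed
    have "t' \<in> {0..2 * T}" "\<Theta>' \<in> {0..2 * pi * real k}"
      unfolding t'_def \<Theta>'_def n_def m_def using fl[of "2 * T" t] fl[of "2 * pi * real k" \<Theta>] T_pos k by auto
    ultimately show "q \<in> orbit (SUsub (cyclic \<gamma>0)) act ` C"
      unfolding C_def by (auto intro!: image_eqI[where x = "(t', \<Theta>')"] image_eqI[where x = "surf 1 t' \<Theta>'"])
  next
    have "C \<subseteq> range (\<lambda>(t, \<Theta>). surf 1 t \<Theta>)"
      unfolding C_def case_prod_unfold by (intro image_mono) simp
    then show "q \<in> orbit (SUsub (cyclic \<gamma>0)) act ` range (\<lambda>(t, \<Theta>). surf 1 t \<Theta>)"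
      if "q \<in> orbit (SUsub (cyclic \<gamma>0)) act ` C" for q
      using that by blast
  qed
  ultimately show ?thesis
    by simp
qed

section \<open>Smoothness and tangent planes of the parametrization\<close>

abbreviation F :: "real^2 \<Rightarrow> (complex^2) \<times> complex" where
  "F x \<equiv> surf 1 (x$1) (x$2)"

lemma has_derivative_cyl:
  fixes x :: "real^2"
  shows "((\<lambda>x. cyl 1 (x$1) (x$2)) has_derivative
    (\<lambda>v. vector [of_real R * (\<i> * of_real (v$2) * cis (x$2)), of_real (v$1 * cosh (x$1)), of_real (v$1 * sinh (x$1))])) (at x)"
proof -
  have nth: "((\<lambda>x. x$i) has_derivative (\<lambda>v. v$i)) (at x)" for i and x :: "real^2"
    by (rule bounded_linear_imp_has_derivative[OF bounded_linear_vec_nth])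
  have 1: "((\<lambda>x. complex_of_real (sinh (x$1))) has_derivative (\<lambda>v. of_real (v$1 * cosh (x$1)))) (at x)"
  proof -
    have "(sinh has_real_derivative cosh y) (at y)" for y
      by (auto intro!: derivative_eq_intros)
    from has_derivative_compose[OF nth this[unfolded has_field_derivative_def]]
    show ?thesis
      by (intro has_derivative_of_real) (simp add: mult.commute)
  qed
  have 2: "((\<lambda>x. complex_of_real (cosh (x$1))) has_derivative (\<lambda>v. of_real (v$1 * sinh (x$1)))) (at x)"
  proof -
    have "(cosh has_real_derivative sinh y) (at y)" for y
      by (auto intro!: derivative_eq_intros)
    from has_derivative_compose[OF nth this[unfolded has_field_derivative_def]]
    show ?thesis
      by (intro has_derivative_of_real) (simp add: mult.commute)
  qed
  have "((\<lambda>x :: real^2. cis (x$2)) has_derivative (\<lambda>v. \<i> * of_real (v$2) * cis (x$2))) (at x)"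
    unfolding cis_conv_exp
    by (rule has_derivative_eq_rhs[OF has_derivative_compose[OF has_derivative_mult_right[OF has_derivative_of_real[OF nth]]
        DERIV_exp[unfolded has_field_derivative_def]]])
      (simp add: fun_eq_iff mult_ac)
  note 3 = has_derivative_mult_right[OF this, of "of_real R"]
  show ?thesis
    unfolding cyl_def mult_1_left by (intro has_derivative_vector_3 1 2 3)
qed

lemma has_derivative_fib:
  "((\<lambda>x :: real^2. fib 1 (x$2)) has_derivative (\<lambda>v. - \<i> * of_real (slope * v$2) * fib 1 (x$2))) (at x)"
proof -
  have nth: "((\<lambda>x. - slope * x$i) has_derivative (\<lambda>v. - slope * v$i)) (at x)" for i and x :: "real^2"
    by (rule has_derivative_mult_right[OF bounded_linear_imp_has_derivative[OF bounded_linear_vec_nth]])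
  have "((\<lambda>x :: real^2. cis (- slope * x$2)) has_derivative (\<lambda>v. - \<i> * of_real (slope * v$2) * cis (- slope * x$2))) (at x)"
    unfolding cis_conv_exp
    by (rule has_derivative_eq_rhs[OF has_derivative_compose[OF has_derivative_mult_right[OF has_derivative_of_real[OF nth]]
        DERIV_exp[unfolded has_field_derivative_def]]])
      (simp add: fun_eq_iff mult_ac)
  from has_derivative_mult_right[OF this, of "of_real ((1 - R\<^sup>2) powr (3/2))"]
  show ?thesis
    unfolding fib_def mult_1_left by (rule has_derivative_eq_rhs) (simp add: fun_eq_iff mult_ac)
qed

lemma Ck_on_cyl: "open U \<Longrightarrow> Ck_on n U (\<lambda>x :: real^2. cyl 1 (x$1) (x$2) $ i)"
proof -
  assume U: "open U"
  have lin: "Ck_on n U (\<lambda>x :: real^2. c * of_real (x$j))" for c :: complex and j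
    by (rule Ck_on_linear[OF U])
      (intro bounded_linear_intros bounded_linear_compose[OF bounded_linear_of_real bounded_linear_vec_nth]
        bounded_linear_compose[OF bounded_linear_mult_right])
  have exp: "Ck_on n U (\<lambda>x :: real^2. exp (c * of_real (x$j)))" for c :: complex and j
    by (rule Ck_on_exp[OF U lin])
  have "Ck_on n U (\<lambda>x :: real^2. of_real R * cis (x$2))"
    unfolding cis_conv_exp by (intro Ck_on_mult U Ck_on_const exp)
  moreover have "Ck_on n U (\<lambda>x :: real^2. (1/2) * exp (1 * of_real (x$1)) + (- 1/2) * exp (- 1 * of_real (x$1)) :: complex)"
    by (intro Ck_on_add Ck_on_mult U Ck_on_const exp)
  then have "Ck_on n U (\<lambda>x :: real^2. of_real (sinh (x$1)) :: complex)"
    by (simp add: sinh_def exp_of_real[symmetric] diff_divide_distrib flip: exp_minus of_real_minus)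
  moreover have "Ck_on n U (\<lambda>x :: real^2. (1/2) * exp (1 * of_real (x$1)) + (1/2) * exp (- 1 * of_real (x$1)) :: complex)"
    by (intro Ck_on_add Ck_on_mult U Ck_on_const exp)
  then have "Ck_on n U (\<lambda>x :: real^2. of_real (cosh (x$1)) :: complex)"
    by (simp add: cosh_def exp_of_real[symmetric] add_divide_distrib flip: exp_minus of_real_minus)
  moreover have "i = 1 \<or> i = 2 \<or> i = 3"
    by (rule exhaust_3)
  ultimately show ?thesis
    by (auto simp: cyl_def)
qed

lemma smooth_on_F: "open U \<Longrightarrow> smooth_on U F"
  unfolding smooth_on_def
proof
  fix n assume U: "open U"
  \<comment> \<open>Inclusions of the three complex coordinates: \<open>F\<close> is a sum of linear
    images of scalar functions, and these are products of entries, the inverse third entry and an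
    exponential.\<close>
  define L1 L2 L3 :: "complex \<Rightarrow> (complex^2) \<times> complex"
    where "L1 c = (vector [c, 0], 0)" and "L2 c = (vector [0, c], 0)" and "L3 c = (0, c)" for c
  have L: "bounded_linear L1" "bounded_linear L2" "bounded_linear L3"
    unfolding linear_conv_bounded_linear[symmetric] L1_def L2_def L3_def
    by (rule linearI; simp add: vec_eq_iff forall_2)+
  define z where "z i x = (A *v cyl 1 (x$1) (x$2)) $ i" for i and x :: "real^2"
  have z: "Ck_on n U (z i)" for i
    unfolding z_def matrix_vector_mult_3 by (intro Ck_on_add Ck_on_mult U Ck_on_const Ck_on_cyl)
  have inv: "Ck_on n U (\<lambda>x. inverse (z 3 x))"
    by (intro Ck_on_inverse U z) (simp add: z_def A_cyl_nz)
  have "Ck_on n U (\<lambda>x :: real^2. exp (\<i> * of_real (- slope * x$2)))"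
    by (intro Ck_on_exp U Ck_on_linear bounded_linear_compose[OF bounded_linear_mult_right]
        bounded_linear_compose[OF bounded_linear_of_real] bounded_linear_vec_nth)
  then have fib: "Ck_on n U (\<lambda>x. fib 1 (x$2))"
    unfolding fib_def cis_conv_exp by (intro Ck_on_mult U Ck_on_const)
  have "F = (\<lambda>x. L1 (z 1 x * inverse (z 3 x)) + (L2 (z 2 x * inverse (z 3 x))
      + L3 (fib 1 (x$2) * (inverse (z 3 x) * (inverse (z 3 x) * inverse (z 3 x))))))"
    by (simp add: fun_eq_iff surf_def proj_pt_def L1_def L2_def L3_def z_def vec_eq_iff forall_2
        divide_inverse power3_eq_cube)
  moreover have "Ck_on n U \<dots>"
    by (intro Ck_on_add U Ck_on_linear_compose[OF U L(1)] Ck_on_linear_compose[OF U L(2)]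
        Ck_on_linear_compose[OF U L(3)] Ck_on_mult z inv fib)
  ultimately show "Ck_on n U F"
    by simp
qed

lemma F_tangent:
  fixes x v :: "real^2"
  defines "D \<equiv> frechet_derivative F (at x)"
  shows "linear D" "contact_form (F x) (D v) = 0" "D v = 0 \<Longrightarrow> v = 0"
proof -
  define Z where "Z = cyl 1 (x$1) (x$2)"
  define Z' where "Z' v = (vector [of_real R * (\<i> * of_real (v$2) * cis (x$2)), of_real (v$1 * cosh (x$1)),
    of_real (v$1 * sinh (x$1))] :: complex^3)" for v :: "real^2"
  define \<eta> where "\<eta> = fib 1 (x$2)"
  define \<eta>' where "\<eta>' v = - \<i> * of_real (slope * v$2) * \<eta>" for v :: "real^2"
  define AZ where "AZ = A *v Z"
  have nz: "AZ $ 3 \<noteq> 0"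
    by (simp add: AZ_def Z_def A_cyl_nz)
  have neg: "Re (herm AZ AZ) < 0"
    by (simp add: AZ_def Z_def herm_A herm_cyl_neg)
  have \<eta>nz: "\<eta> \<noteq> 0"
    using R_bounds by (simp add: \<eta>_def fib_def)
  have "((\<lambda>x. A *v cyl 1 (x$1) (x$2)) has_derivative (\<lambda>v. A *v Z' v)) (at x)"
    unfolding Z'_def by (rule bounded_linear.has_derivative[OF bounded_linear_matrix_vector_mult has_derivative_cyl])
  from has_derivative_proj_pt[OF this has_derivative_fib A_cyl_nz]
  have hd: "(F has_derivative (\<lambda>v. (vector [((A *v Z' v) $ 1 - AZ $ 1 / AZ $ 3 * (A *v Z' v) $ 3) / AZ $ 3,
        ((A *v Z' v) $ 2 - AZ $ 2 / AZ $ 3 * (A *v Z' v) $ 3) / AZ $ 3],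
      (\<eta>' v - 3 * \<eta> * (A *v Z' v) $ 3 / AZ $ 3) / AZ $ 3 ^ 3))) (at x)"
    unfolding surf_def AZ_def Z_def \<eta>_def \<eta>'_def .
  show "linear D"
    unfolding D_def using hd by (intro linear_frechet_derivative) (auto simp: differentiable_def)
  have D: "D v = (vector [((A *v Z' v) $ 1 - AZ $ 1 / AZ $ 3 * (A *v Z' v) $ 3) / AZ $ 3,
        ((A *v Z' v) $ 2 - AZ $ 2 / AZ $ 3 * (A *v Z' v) $ 3) / AZ $ 3],
      (\<eta>' v - 3 * \<eta> * (A *v Z' v) $ 3 / AZ $ 3) / AZ $ 3 ^ 3)"
    unfolding D_def frechet_derivative_at[OF hd, symmetric] ..
  show "contact_form (F x) (D v) = 0"
  proof -
    have "of_real R * (\<i> * of_real (v$2) * cis (x$2)) * cnj (of_real R * cis (x$2))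
        = \<i> * of_real (R\<^sup>2 * v$2) * (cis (x$2) * cis (- (x$2)))"
      by (simp add: cis_cnj power2_eq_square mult_ac)
    \<comment> \<open>The terms in \<open>v$1\<close> are \<open>cosh * sinh\<close> with opposite
      signs and cancel, so only the rotation contributes.\<close>
    then have h1: "herm (Z' v) Z = \<i> * of_real (R\<^sup>2 * v$2)"
      by (simp add: herm_def Z'_def Z_def cyl_def cis_mult)
    have h2: "herm Z Z = of_real (R\<^sup>2 - 1)"
      by (subst herm_self) (simp add: Z_def herm_cyl)
    \<comment> \<open>With the common denominator \<open>n\<close>, \<open>1 - R\<^sup>2\<close> is
      \<open>3 * k / n\<close>. Hence the quotient of \<open>3 * R\<^sup>2\<close> by
      \<open>R\<^sup>2 - 1\<close> is \<open>- l / k\<close>, which is the logarithmic derivative of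
      the fibre.\<close>
    define n where "n = 3 * real k + real l"
    have "n \<noteq> 0"
      using k by (simp add: n_def)
    moreover have "R\<^sup>2 = real l / n" "R\<^sup>2 - 1 = - (3 * real k) / n"
      using \<open>n \<noteq> 0\<close> by (simp_all add: R_sq n_def field_simps)
    ultimately have "3 * (R\<^sup>2 * v$2) / (R\<^sup>2 - 1) = - (slope * v$2)"
      using k by (simp add: slope_def)
    then have h3: "3 * (\<i> * of_real (R\<^sup>2 * v$2)) / of_real (R\<^sup>2 - 1) = \<i> * complex_of_real (- (slope * v$2))"
      by (metis (no_types, opaque_lifting) mult.left_commute of_real_divide of_real_mult of_real_numeral times_divide_eq_right)
    have "3 * herm (A *v Z' v) AZ / herm AZ AZ = \<i> * of_real (- (slope * v$2))"
      by (simp only: AZ_def herm_A h1 h2 h3)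
    moreover have "\<eta>' v / \<eta> = - \<i> * of_real (slope * v$2)"
      using \<eta>nz by (simp add: \<eta>'_def)
    moreover have "F x = proj_pt AZ \<eta>"
      by (simp add: surf_def AZ_def Z_def \<eta>_def)
    ultimately show ?thesis
      unfolding D by (simp only: contact_form_proj_pt[OF neg \<eta>nz]) simp
  qed
  show "v = 0" if "D v = 0"
  proof -
    define c where "c = (A *v Z' v) $ 3 / AZ $ 3"
    have "vector [((A *v Z' v) $ 1 - AZ $ 1 / AZ $ 3 * (A *v Z' v) $ 3) / AZ $ 3,
        ((A *v Z' v) $ 2 - AZ $ 2 / AZ $ 3 * (A *v Z' v) $ 3) / AZ $ 3] = (0 :: complex^2)"
      using that unfolding D by (simp add: zero_prod_def)
    \<comment> \<open>A vanishing base component means that the homogeneous tangent vector is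
      proportional to the position vector: the surface is immersed already in the ball.\<close>
    then have "A *v Z' v = c *s AZ"
      using nz by (simp add: c_def vec_eq_iff forall_2 forall_3 mult.commute)
    then have "matrix_inv A *v (A *v Z' v) = matrix_inv A *v (A *v (c *s Z))"
      by (simp add: AZ_def vector_scalar_commute)
    then have "Z' v = c *s Z"
      by (simp add: matrix_vector_mul_assoc matrix_inv_SU21(2)[OF A])
    then have c: "of_real R * (\<i> * of_real (v$2) * cis (x$2)) = c * (of_real R * cis (x$2))"
      "of_real (v$1 * cosh (x$1)) = c * of_real (sinh (x$1))" "of_real (v$1 * sinh (x$1)) = c * of_real (cosh (x$1))"
      by (simp_all add: Z'_def Z_def cyl_def vec_eq_iff forall_3)
    \<comment> \<open>The first coordinate makes \<open>c\<close> purely imaginary, while the other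
      two equations relate \<open>c\<close> to real numbers; comparing real and imaginary parts
      kills both components of \<open>v\<close>.\<close>
    then have "c = \<i> * of_real (v$2)"
      using R_bounds by (simp add: mult_ac)
    with c(2,3) have "v$1 * cosh (x$1) = 0" "v$2 * cosh (x$1) = 0"
      by (simp_all add: complex_eq_iff)
    then show "v = 0"
      by (simp add: vec_eq_iff forall_2)
  qed
qed

text \<open>In the \<open>t\<close> direction the patch has length \<open>T\<close>, so no
  nontrivial power of \<open>\<gamma>0\<close> identifies two of its points. In the angle it is
  narrow enough for \<open>openin_sheets_surf\<close>.\<close>

lemma legendrian_patch_F:
  assumes \<Gamma>: "subgroup \<Gamma> SU21" "\<gamma>0 \<in> \<Gamma>"
  defines "W t \<Theta> \<equiv> {x :: real^2. \<bar>x$1 - t\<bar> < T / 2 \<and> \<bar>x$2 - \<Theta>\<bar> < patch_width}"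
  shows "legendrian_patch \<Gamma> (subtopology (P_quot (cyclic \<gamma>0)) (Lambda \<gamma>0 A k l)) (natural_proj \<Gamma>)
    (W t \<Theta>) (\<lambda>x. orbit (SUsub (cyclic \<gamma>0)) act (F x)) F"
proof -
  have W: "open (W t \<Theta>)"
  proof -
    have "W t \<Theta> = (\<lambda>x. x$1) -` ball t (T/2) \<inter> (\<lambda>x. x$2) -` ball \<Theta> patch_width"
      by (auto simp: W_def dist_real_def abs_minus_commute)
    then show ?thesis
      by (simp add: open_Int open_vimage_vec_nth)
  qed
  have "F x \<in> Lambda_tilde A k l" for x
    unfolding Lambda_tilde_eq by (rule range_eqI[of _ _ "(x$1, x$2)"]) simp
  then have FL: "F ` W t \<Theta> \<subseteq> Lambda_tilde A k l"
    by blast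
  have FP: "F x \<in> Ptilde" for x
    by (rule surf_in_Ptilde) simp
  have "continuous_on UNIV (\<lambda>x :: real^2. F x)"
    using continuous_on_compose2[OF continuous_on_surf, of UNIV "\<lambda>x :: real^2. (x$1, x$2)"]
    by (simp add: continuous_on_Pair continuous_on_component)
  then have cont: "continuous_on (W t \<Theta>) F"
    by (rule continuous_on_subset) simp
  have sub: "Lambda_tilde A k l \<subseteq> sheets"
    by (auto simp: Lambda_tilde_eq sheets_def)
  have op: "openin (top_of_set sheets) (F ` (W t \<Theta> \<inter> W'))" if "open W'" for W'
    using W that by (intro openin_sheets_surf[of _ \<Theta>]) (auto simp: W_def)
  have inv: "act g p \<in> sheets" if "g \<in> carrier (SUsub (cyclic \<gamma>0))" "p \<in> sheets" for g p
    using that(1) act_pow_sheets[OF that(2)] by (auto simp: cyclic_eq[OF \<gamma>0])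
  have inj: "inj_on (\<lambda>x. orbit (SUsub (cyclic \<gamma>0)) act (F x)) (W t \<Theta>)"
  proof (rule inj_onI)
    fix x y assume x: "x \<in> W t \<Theta>" and y: "y \<in> W t \<Theta>"
      and "orbit (SUsub (cyclic \<gamma>0)) act (F x) = orbit (SUsub (cyclic \<gamma>0)) act (F y)"
    then obtain n :: int where n: "F y = act (\<gamma>0 [^]\<^bsub>SU21\<^esub> n) (F x)"
      using cyc.orbit_eq_iff[OF FP FP, of x y] by (auto simp: cyclic_eq[OF \<gamma>0])
    have "height (F y) = height (F x) + of_int n * T"
      unfolding n by (rule height_act_pow[OF FP])
    then have "y$1 = x$1 + of_int n * T"
      by (simp add: height_surf)
    moreover have "\<bar>x$1 - t\<bar> < T / 2" "\<bar>y$1 - t\<bar> < T / 2"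
      using x y by (simp_all add: W_def)
    ultimately have "\<bar>of_int n * T\<bar> < 1 * T"
      by linarith
    then have "\<bar>of_int n :: real\<bar> < 1"
      using T_pos by (simp add: abs_mult)
    then have "n = 0"
      by linarith
    then have eq: "F y = F x"
      using n by (simp add: act_one FP)
    have "x$1 = y$1"
      using arg_cong[OF eq, of height] by (simp add: height_surf)
    \<comment> \<open>Equal points have equal angles because \<open>Arg\<close> of the rotated base
      coordinate recovers the angle within the patch.\<close>
    moreover have Arg: "Arg (base_coord \<Theta> (F z)) = z$2 - \<Theta>" if "z \<in> W t \<Theta>" for z
    proof -
      have "\<bar>z$2 - \<Theta>\<bar> < patch_width"
        using that by (simp add: W_def)
      then have "- pi < z$2 - \<Theta>" "z$2 - \<Theta> \<le> pi"
        using patch_bounds(3,4) pi_gt_zero by linarith+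
      then have "Arg (of_real (R / cosh (z$1)) * cis (z$2 - \<Theta>)) = z$2 - \<Theta>"
        using R_bounds by (intro Arg_of_real_cis) simp_all
      then show ?thesis
        by (simp only: base_coord_surf norm_one mult_1_left)
    qed
    then have "x$2 = y$2"
      using Arg[OF x] Arg[OF y] eq by simp
    ultimately show "x = y"
      by (simp add: vec_eq_iff forall_2)
  qed
  have cyc: "cyclic \<gamma>0 \<subseteq> \<Gamma>"
    unfolding cyclic_def using SU21.generate_subgroup_incl[OF _ \<Gamma>(1)] \<Gamma>(2) by simp
  note hom = cyc.homeomorphic_map_orbit_local_section[OF sheets_subset inv sub FL cont op inj]
  show ?thesis
    unfolding legendrian_patch_def Lambda_eq_image
    using W hom FP smooth_on_F[OF W] F_tangent natural_proj_orbit[OF \<Gamma>(1) subgroup_cyclic cyc FP]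
    by (auto simp: linear_injective_0)
qed

lemma legendrian_submanifold_Lambda:
  assumes \<Gamma>: "subgroup \<Gamma> SU21" "\<gamma>0 \<in> \<Gamma>"
  shows "legendrian_submanifold \<Gamma> (subtopology (P_quot (cyclic \<gamma>0)) (Lambda \<gamma>0 A k l)) (natural_proj \<Gamma>)"
  unfolding legendrian_submanifold_def
proof (intro conjI ballI)
  show "Hausdorff_space (subtopology (P_quot (cyclic \<gamma>0)) (Lambda \<gamma>0 A k l))"
    by (rule Hausdorff_space_subtopology[OF Hausdorff_P_quot_cyclic])
  have "second_countable (top_of_set Ptilde)"
    by (rule second_countable_subtopology[OF second_countable_euclidean])
  then show "second_countable (subtopology (P_quot (cyclic \<gamma>0)) (Lambda \<gamma>0 A k l))"
    by (rule second_countable_subtopology[OF cyc.second_countable_orbit_space])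
  have "cyclic \<gamma>0 \<subseteq> \<Gamma>"
    unfolding cyclic_def using SU21.generate_subgroup_incl[OF _ \<Gamma>(1)] \<Gamma>(2) by simp
  then show "continuous_map (subtopology (P_quot (cyclic \<gamma>0)) (Lambda \<gamma>0 A k l)) (P_quot \<Gamma>) (natural_proj \<Gamma>)"
    by (intro continuous_map_from_subtopology continuous_map_natural_proj \<Gamma>(1) subgroup_cyclic)
  fix q assume "q \<in> topspace (subtopology (P_quot (cyclic \<gamma>0)) (Lambda \<gamma>0 A k l))"
  then obtain t \<Theta> where q: "q = orbit (SUsub (cyclic \<gamma>0)) act (surf 1 t \<Theta>)"
    by (auto simp: Lambda_eq_image Lambda_tilde_eq)
  show "\<exists>W h F. legendrian_patch \<Gamma> (subtopology (P_quot (cyclic \<gamma>0)) (Lambda \<gamma>0 A k l)) (natural_proj \<Gamma>) W h F \<and> q \<in> h ` W"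
  proof (intro exI conjI)
    show "q \<in> (\<lambda>x. orbit (SUsub (cyclic \<gamma>0)) act (F x)) `
        {x. \<bar>x$1 - t\<bar> < T / 2 \<and> \<bar>x$2 - \<Theta>\<bar> < patch_width}"
      using T_pos patch_bounds(2) by (intro image_eqI[where x = "vector [t, \<Theta>]"]) (simp_all add: q)
  qed (rule legendrian_patch_F[OF \<Gamma>])
qed

text \<open>\<open>A\<close> intertwines \<open>\<gamma>\<close> with \<open>\<gamma>0\<close>,
  hence also their powers, and so carries orbits of one cyclic group onto orbits of the
  other.\<close>

lemma T_quot_eq_Lambda:
  assumes \<gamma>: "\<gamma> = matrix_inv A ** \<gamma>0 ** A"
  shows "(\<lambda>Q. act A ` Q) ` T_quot \<gamma> k l = Lambda \<gamma>0 A k l"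
proof -
  have A': "matrix_inv A \<in> carrier SU21"
    by (rule matrix_inv_SU21(1)[OF A])
  have \<gamma>_SU: "\<gamma> \<in> carrier SU21"
    using SU21.m_closed[OF SU21.m_closed[OF A' \<gamma>0] A] by (simp add: \<gamma>)
  have A\<gamma>: "A ** \<gamma> = \<gamma>0 ** A"
    using matrix_inv_SU21(3)[OF A] by (simp add: \<gamma> matrix_mul_assoc)
  have conj: "act A (act (\<gamma> [^]\<^bsub>SU21\<^esub> n) p) = act (\<gamma>0 [^]\<^bsub>SU21\<^esub> n) (act A p)" if p: "p \<in> Ptilde" for p and n :: int
  proof -
    define \<Phi> where "\<Phi> n = act A (act (\<gamma> [^]\<^bsub>SU21\<^esub> n) p)" for n :: int
    have pow: "act (\<gamma> [^]\<^bsub>SU21\<^esub> n) p \<in> Ptilde" for n :: int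
      by (rule act_in_Ptilde[OF SU21.int_pow_closed[OF \<gamma>_SU] p])
    have "act (\<gamma>0 [^]\<^bsub>SU21\<^esub> n) (\<Phi> 0) = \<Phi> (0 + n)"
      using \<gamma>0
    proof (rule act_int_pow)
      show "\<Phi> n \<in> Ptilde" for n
        unfolding \<Phi>_def by (rule act_in_Ptilde[OF A pow])
      show "act \<gamma>0 (\<Phi> n) = \<Phi> (n + 1)" for n
      proof -
        have "act \<gamma>0 (\<Phi> n) = act A (act \<gamma> (act (\<gamma> [^]\<^bsub>SU21\<^esub> n) p))"
          unfolding \<Phi>_def act_mult[OF \<gamma>0 A pow, symmetric] act_mult[OF A \<gamma>_SU pow, symmetric] A\<gamma> ..
        also have "act \<gamma> (act (\<gamma> [^]\<^bsub>SU21\<^esub> n) p) = act (\<gamma> [^]\<^bsub>SU21\<^esub> (n + 1)) p"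
          using act_mult[OF \<gamma>_SU SU21.int_pow_closed[OF \<gamma>_SU] p, of n] SU21.int_pow_mult[OF \<gamma>_SU, of 1 n] \<gamma>_SU
          by (simp add: add.commute)
        finally show ?thesis
          by (simp add: \<Phi>_def)
      qed
    qed
    then show ?thesis
      by (simp add: \<Phi>_def act_one p)
  qed
  have "act A ` orbit (SUsub (cyclic \<gamma>)) act p = orbit (SUsub (cyclic \<gamma>0)) act (act A p)" if "p \<in> T_tilde k l" for p
  proof -
    have orb: "orbit (SUsub (cyclic g)) act q = range (\<lambda>n::int. act (g [^]\<^bsub>SU21\<^esub> n) q)" if "g \<in> carrier SU21" for g q
      by (auto simp: orbit_def cyclic_eq[OF that])
    have "p \<in> Ptilde"
      using that T_tilde_subset by auto
    then show ?thesis
      by (simp add: orb[OF \<gamma>_SU] orb[OF \<gamma>0] image_image conj)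
  qed
  then show ?thesis
    unfolding T_quot_def orbits_def Lambda_eq_image Lambda_tilde_def Setcompr_eq_image image_image
    by (rule image_cong[OF refl])
qed

end

theorem proposition4p3:
  fixes \<Gamma> :: "(complex^3^3) set"
    and \<gamma>0 M A \<gamma> :: "complex^3^3"
    and X Y v :: "complex^3"
    and lam :: real
    and k l :: nat
  assumes "subgroup \<Gamma> SU21" and "discrete \<Gamma>" and "cocompact \<Gamma>" and "smooth_quotient \<Gamma>"
    and "\<gamma>0 \<in> \<Gamma>" and "hyperbolic \<gamma>0"
    and "is_lift M \<gamma>0"
    and "null_vec X" and "M *v X = of_real lam *s X"
    and "null_vec Y" and "M *v Y = of_real (inverse lam) *s Y"
    and "positive_vec v" and "M *v v = v"
    and "\<bar>lam\<bar> > 1"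
    and "A = frame_matrix v X Y" and "A \<in> carrier SU21"
    and "\<gamma> = matrix_inv A ** \<gamma>0 ** A"
    and "k > 0" and "l > 0"
  shows "(\<lambda>Q. act A ` Q) ` T_quot \<gamma> k l = Lambda \<gamma>0 A k l
    \<and> compactin (P_quot (cyclic \<gamma>0)) (Lambda \<gamma>0 A k l)
    \<and> legendrian_submanifold \<Gamma>
         (subtopology (P_quot (cyclic \<gamma>0)) (Lambda \<gamma>0 A k l)) (natural_proj \<Gamma>)"
proof -
  have MA: "M ** A = A ** boost lam"
    unfolding \<open>A = _\<close> by (rule frame_matrix_boost) fact+
  \<comment> \<open>A lift is only known to lie in U(2,1). The conjugation to
    \<open>boost lam\<close>, of determinant 1, puts it into SU(2,1), where
    \<open>act_proj_pt\<close> applies.\<close>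
  have "det M * det A = det A * det (boost lam)"
    using MA by (metis det_mul)
  then have "det M = 1"
    using \<open>A \<in> carrier SU21\<close> \<open>\<bar>lam\<bar> > 1\<close> by (auto simp: carrier_SU21 det_boost)
  then have M: "M \<in> carrier SU21"
    using \<open>is_lift M \<gamma>0\<close> by (simp add: carrier_SU21 is_lift_def)
  interpret boost_surface \<gamma>0 A lam k l
  proof
    show "\<gamma>0 \<in> carrier SU21"
      using subgroup.subset[OF \<open>subgroup \<Gamma> SU21\<close>] \<open>\<gamma>0 \<in> \<Gamma>\<close> by auto
    fix Z \<eta> assume "Re (herm Z Z) < 0"
    then have neg: "Re (herm (A *v Z) (A *v Z)) < 0"
      using \<open>A \<in> carrier SU21\<close> by (simp add: carrier_SU21 herm_mult_U21)
    then have "rho (fst (proj_pt (A *v Z) \<eta>)) > 0"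
      using herm_neg_third[OF neg] by (simp add: rho_proj_pt divide_neg_pos)
    \<comment> \<open>The matrices may differ, but they induce the same map of the ball, hence the
      same Jacobi matrices and the same action on the bundle.\<close>
    then have "act \<gamma>0 (proj_pt (A *v Z) \<eta>) = act M (proj_pt (A *v Z) \<eta>)"
      using \<open>is_lift M \<gamma>0\<close> unfolding Ball2_iff[symmetric] by (intro act_cong) (auto simp: is_lift_def)
    also have "\<dots> = proj_pt (A *v (boost lam *v Z)) \<eta>"
      unfolding act_proj_pt[OF M neg] by (simp add: matrix_vector_mul_assoc MA)
    finally show "act \<gamma>0 (proj_pt (A *v Z) \<eta>) = proj_pt (A *v (boost lam *v Z)) \<eta>" .
  qed fact+
  show ?thesis
    using T_quot_eq_Lambda compactin_Lambda legendrian_submanifold_Lambda assms by blast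
qed

end
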